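(* Consider a convex resource theory, let $\psi=|\psi\rangle\langle\psi|$ be a target pure resource state on $\mathcal H$, let $m\ge 1$ be an integer, let $\varepsilon\in[0,1)$, and let $\rho$ be a density operator on $\mathcal H_{\rm in}$. Let $\mathcal O$ be the class of resource non-generating operations, and let $C^\varepsilon(\rho,m)$ be the virtual distillation overhead with respect to $\mathcal O$. (i) If $R^s_{\mathcal F}(\psi)<\infty$, then $$\zeta^s_\varepsilon\left(\rho, F_{\mathcal F}(\psi^{\otimes m})^{-1}\right)\;\le\; C^\varepsilon(\rho,m)\;\le\;\zeta^s_\varepsilon\left(\rho, R^s_{\mathcal F}(\psi^{\otimes m})+1\right).$$ (ii) Furthermore, if $\langle\psi|\sigma|\psi\rangle$ is constant for all $\sigma\in\mathcal F$ (that is, it takes the same value for all free states $\sigma$ on $\mathcal H$), then $$\zeta^g_\varepsilon\left(\rho, F_{\mathcal F}(\psi^{\otimes m})^{-1}\right)\;\le\; C^\varepsilon(\rho,m)\;\le\;\zeta^g_\varepsilon\left(\rho, R^g_{\mathcal F}(\psi^{\otimes m})+1\right).$$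
   Context: All Hilbert spaces are finite-dimensional. A (convex) resource theory specifies, for each system with Hilbert space $\mathcal K$ under consideration (here $\mathcal H_{\rm in}$, $\mathcal H$ and $\mathcal H^{\otimes m}$), a nonempty, closed, convex set $\mathcal F(\mathcal K)$ of density operators on $\mathcal K$, called free states; one writes $\mathcal F$ when the space is clear. $\mathcal D$ denotes the set of all density operators (on the relevant space). A resource non-generating operation (here from $\mathcal H_{\rm in}$ to $\mathcal H^{\otimes m}$) is a completely positive trace-preserving map $\Lambda$ such that $\Lambda(\sigma)\in\mathcal F(\mathcal H^{\otimes m})$ for all $\sigma\in\mathcal F(\mathcal H_{\rm in})$. Virtual distillation overhead with respect to a set $\mathcal O$ of operations: $$C^\varepsilon(\rho,m)=\inf\Big\{\lambda_++\lambda_- \;:\; \lambda_\pm\ge0,\ \lambda_+-\lambda_-=1,\ \Lambda_\pm\in\mathcal O,\ \tfrac12\big\|\lambda_+\Lambda_+(\rho)-\lambda_-\Lambda_-(\rho)-\psi^{\otimes m}\big\|_1\le\varepsilon\Big\},$$ where $\|A\|_1=\operatorname{Tr}\sqrt{A^\dagger A}$. Resource measures of a state $\tau$ (on its space, with the free states of that space): - generalized robustness $R^g_{\mathcal F}(\tau)=\inf\{\lambda\ge0 : \frac{\tau+\lambda\omega}{1+\lambda}\in\mathcal F \text{ for some }\omega\in\mathcal D\}$; - standard robustness $R^s_{\mathcal F}(\tau)=\inf\{\lambda\ge0 : \frac{\tau+\lambda\sigma}{1+\lambda}\in\mathcal F\text{ for some }\sigma\in\mathcal F\}$; - resource fidelity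 $F_{\mathcal F}(\tau)=\max_{\sigma\in\mathcal F}\big(\operatorname{Tr}\sqrt{\tau^{1/2}\sigma\tau^{1/2}}\big)^2$. For a parameter $k$, $\zeta^s_\varepsilon(\rho,k)$ is the optimal (minimal) value of $\mu_++\mu_-$ over real numbers $\mu_\pm$ and Hermitian operators $Q_\pm$ on $\mathcal H_{\rm in}$ satisfying - $0\le Q_+\le\mu_+ I$ and $0\le Q_-\le\mu_- I$; - $\operatorname{Tr}Q_+\sigma\le \mu_+/k$ and $\operatorname{Tr}Q_-\sigma\le\mu_-/k$ for all $\sigma\in\mathcal F(\mathcal H_{\rm in})$; - $\mu_+-\mu_-=1$; - $\operatorname{Tr}\rho(Q_+-Q_-)\ge1-\varepsilon$. $\zeta^g_\varepsilon(\rho,k)$ is the same optimization problem with the inequalities in the second item replaced by equalities: $\operatorname{Tr}Q_+\sigma=\mu_+/k$ and $\operatorname{Tr}Q_-\sigma=\mu_-/k$ for all $\sigma\in\mathcal F(\mathcal H_{\rm in})$. Conventions: the optimal value of an infeasible problem (infimum over an empty set) is $+\infty$; $0^{-1}=+\infty$; and $\mu/k=0$ when $k=+\infty$.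
   Formalization: The lower bound in (ii) is proved under the additional assumption that the overlap of ψ^{⊗m} with σ is constant over all free states σ on H^{⊗m}; constancy of ⟨ψ|σ|ψ⟩ on H alone does not suffice when m ≥ 2. *)

theory Defs
  imports "HOL-Analysis.Analysis"
begin

text \<open>
  A finite-dimensional Hilbert space is \<open>complex^'n\<close>, and an operator from \<open>complex^'a\<close> to
  \<open>complex^'b\<close> is a matrix \<open>complex^'a^'b\<close>.  The library has no inner product with complex
  values on these types; \<open>cdot\<close> is conjugate-linear in its first argument.
\<close>

definition cdot :: "complex^'n \<Rightarrow> complex^'n \<Rightarrow> complex" where
  "cdot x y = (\<Sum>i\<in>UNIV. cnj (x $ i) * y $ i)"

definition dagger :: "complex^'n^'m \<Rightarrow> complex^'m^'n" where
  "dagger A = (\<chi> i j. cnj (A $ j $ i))"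

definition hermitian :: "complex^'n^'n \<Rightarrow> bool" where
  "hermitian A \<longleftrightarrow> dagger A = A"

text \<open>
  The values of the quadratic form are required to be real, so positivity contains hermiticity.
  The order \<open>\<le>\<close> of the type \<open>vec\<close> is componentwise, hence the separate Loewner order.
\<close>

definition psd :: "complex^'n^'n \<Rightarrow> bool" where
  "psd A \<longleftrightarrow> (\<forall>v. cdot v (A *v v) \<in> \<real>\<^sub>\<ge>\<^sub>0)"

definition loewner_le :: "complex^'n^'n \<Rightarrow> complex^'n^'n \<Rightarrow> bool" where
  "loewner_le A B \<longleftrightarrow> psd (B - A)"

definition psd_sqrt :: "complex^'n^'n \<Rightarrow> complex^'n^'n" where
  "psd_sqrt A = (THE B. psd B \<and> B ** B = A)"

definition trace_norm :: "complex^'n^'n \<Rightarrow> real" where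
  "trace_norm A = Re (trace (psd_sqrt (dagger A ** A)))"

definition density_operator :: "complex^'n^'n \<Rightarrow> bool" where
  "density_operator \<rho> \<longleftrightarrow> psd \<rho> \<and> trace \<rho> = 1"

definition ketbra :: "complex^'n \<Rightarrow> complex^'n^'n" where
  "ketbra \<psi> = (\<chi> i j. \<psi> $ i * cnj (\<psi> $ j))"

text \<open>
  The tensor power of \<open>complex^'n\<close> with \<open>m = CARD('m)\<close> factors is the space \<open>complex^('m \<Rightarrow> 'n)\<close>:
  its standard basis is indexed by the families of \<open>m\<close> basis indices.
\<close>

definition tensor_power :: "complex^'n \<Rightarrow> complex^('m::finite \<Rightarrow> 'n)" where
  "tensor_power \<psi> = (\<chi> f. \<Prod>i\<in>UNIV. \<psi> $ f i)"

lemma ketbra_tensor_power: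
  "ketbra (tensor_power \<psi>) $ f $ g = (\<Prod>i\<in>UNIV. ketbra \<psi> $ f i $ g i)"
  by (simp add: ketbra_def tensor_power_def prod.distrib)

definition free_states :: "(complex^'n^'n) set \<Rightarrow> bool" where
  "free_states F \<longleftrightarrow> F \<noteq> {} \<and> closed F \<and> convex F \<and> (\<forall>\<sigma>\<in>F. density_operator \<sigma>)"

definition matrix_cscale :: "complex \<Rightarrow> complex^'n^'m \<Rightarrow> complex^'n^'m" where
  "matrix_cscale c A = (\<chi> i j. c * A $ i $ j)"

text \<open>
  An operator on the tensor product of an \<open>n\<close>-dimensional space with \<open>complex^'a\<close> is an
  \<open>n \<times> n\<close> block matrix \<open>X\<close> with blocks in \<open>complex^'a^'a\<close>, and the tensor product of the
  identity map with \<open>\<Lambda>\<close> acts on it blockwise.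
\<close>

definition block_psd :: "nat \<Rightarrow> (nat \<Rightarrow> nat \<Rightarrow> complex^'a^'a) \<Rightarrow> bool" where
  "block_psd n X \<longleftrightarrow>
     (\<forall>v :: nat \<Rightarrow> complex^'a. (\<Sum>i<n. \<Sum>j<n. cdot (v i) (X i j *v v j)) \<in> \<real>\<^sub>\<ge>\<^sub>0)"

definition completely_positive :: "(complex^'a^'a \<Rightarrow> complex^'b^'b) \<Rightarrow> bool" where
  "completely_positive \<Lambda> \<longleftrightarrow>
     (\<forall>n X. block_psd n X \<longrightarrow> block_psd n (\<lambda>i j. \<Lambda> (X i j)))"

definition cptp :: "(complex^'a^'a \<Rightarrow> complex^'b^'b) \<Rightarrow> bool" where
  "cptp \<Lambda> \<longleftrightarrow>
     (\<forall>A B. \<Lambda> (A + B) = \<Lambda> A + \<Lambda> B) \<and>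
     (\<forall>c A. \<Lambda> (matrix_cscale c A) = matrix_cscale c (\<Lambda> A)) \<and>
     completely_positive \<Lambda> \<and>
     (\<forall>A. trace (\<Lambda> A) = trace A)"

definition rng_operations ::
    "(complex^'a^'a) set \<Rightarrow> (complex^'b^'b) set \<Rightarrow> (complex^'a^'a \<Rightarrow> complex^'b^'b) set" where
  "rng_operations F G = {\<Lambda>. cptp \<Lambda> \<and> (\<forall>\<sigma>\<in>F. \<Lambda> \<sigma> \<in> G)}"

text \<open>
  The optimal values below are extended reals, where the infimum of the empty set is \<open>\<infinity>\<close>.
\<close>

definition virtual_overhead ::
    "(complex^'a^'a \<Rightarrow> complex^'b^'b) set \<Rightarrow> real \<Rightarrow> complex^'a^'a \<Rightarrow> complex^'b^'b \<Rightarrow> ereal" where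
  "virtual_overhead Ops \<epsilon> \<rho> target =
     Inf {ereal (lp + lm) | lp lm.
            0 \<le> lp \<and> 0 \<le> lm \<and> lp - lm = 1 \<and>
            (\<exists>\<Lambda>p\<in>Ops. \<exists>\<Lambda>m\<in>Ops.
               1/2 * trace_norm (lp *\<^sub>R \<Lambda>p \<rho> - lm *\<^sub>R \<Lambda>m \<rho> - target) \<le> \<epsilon>)}"

definition generalized_robustness :: "(complex^'n^'n) set \<Rightarrow> complex^'n^'n \<Rightarrow> ereal" where
  "generalized_robustness F \<tau> =
     Inf {ereal l | l. 0 \<le> l \<and> (\<exists>\<omega>. density_operator \<omega> \<and> (1 / (1 + l)) *\<^sub>R (\<tau> + l *\<^sub>R \<omega>) \<in> F)}"

definition standard_robustness :: "(complex^'n^'n) set \<Rightarrow> complex^'n^'n \<Rightarrow> ereal" where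
  "standard_robustness F \<tau> =
     Inf {ereal l | l. 0 \<le> l \<and> (\<exists>\<sigma>\<in>F. (1 / (1 + l)) *\<^sub>R (\<tau> + l *\<^sub>R \<sigma>) \<in> F)}"

definition resource_fidelity :: "(complex^'n^'n) set \<Rightarrow> complex^'n^'n \<Rightarrow> ereal" where
  "resource_fidelity F \<tau> =
     (SUP \<sigma>\<in>F. ereal ((Re (trace (psd_sqrt (psd_sqrt \<tau> ** \<sigma> ** psd_sqrt \<tau>))))\<^sup>2))"

text \<open>
  The relation \<open>R\<close> compares \<open>Tr Q\<sigma>\<close> with \<open>\<mu>/k\<close>.  Division of extended reals gives
  \<open>\<mu>/\<infinity> = 0\<close>, as required, and \<open>inverse 0 = \<infinity>\<close>.
\<close>

definition zeta_program ::
    "(ereal \<Rightarrow> ereal \<Rightarrow> bool) \<Rightarrow> (complex^'a^'a) set \<Rightarrow> real \<Rightarrow> complex^'a^'a \<Rightarrow> ereal \<Rightarrow> ereal" where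
  "zeta_program R F \<epsilon> \<rho> k =
     Inf {ereal (\<mu>p + \<mu>m) | \<mu>p \<mu>m.
            \<exists>Qp Qm :: complex^'a^'a.
              hermitian Qp \<and> hermitian Qm \<and>
              loewner_le 0 Qp \<and> loewner_le Qp (\<mu>p *\<^sub>R mat 1) \<and>
              loewner_le 0 Qm \<and> loewner_le Qm (\<mu>m *\<^sub>R mat 1) \<and>
              (\<forall>\<sigma>\<in>F. R (ereal (Re (trace (Qp ** \<sigma>)))) (ereal \<mu>p / k) \<and>
                     R (ereal (Re (trace (Qm ** \<sigma>)))) (ereal \<mu>m / k)) \<and>
              \<mu>p - \<mu>m = 1 \<and>
              Re (trace (\<rho> ** (Qp - Qm))) \<ge> 1 - \<epsilon>}"

definition zeta_s :: "(complex^'a^'a) set \<Rightarrow> real \<Rightarrow> complex^'a^'a \<Rightarrow> ereal \<Rightarrow> ereal" where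
  "zeta_s = zeta_program (\<le>)"

definition zeta_g :: "(complex^'a^'a) set \<Rightarrow> real \<Rightarrow> complex^'a^'a \<Rightarrow> ereal \<Rightarrow> ereal" where
  "zeta_g = zeta_program (=)"

text \<open>
  Free states on the single-copy space and on the \<open>m\<close>-copy space form unrelated sets, so constant
  overlap of \<open>\<psi>\<close> on the former does not give constant overlap of its tensor power on the latter.
  Already for \<open>m = 2\<close> the lower bound by \<open>zeta_g\<close> fails without the latter, even if the two sets
  are compatible under tensor products and partial traces.  With the single-copy set
  \<open>{I/2}\<close> on a qubit, \<open>\<psi> = |0>\<close>, and the diagonal states
  \<open>(1+c)/4 (|00><00| + |11><11|) + (1-c)/4 (|01><01| + |10><10|)\<close> for \<open>0 \<le> c \<le> 1/2\<close> as the
  free states of both the input and the output, \<open>\<rho> = |00><00|\<close> and \<open>\<epsilon> = 0\<close>, the overhead is \<open>1\<close>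
  and the lower bound would be \<open>5/3\<close>.
\<close>

definition constant_overlap :: "(complex^'n^'n) set \<Rightarrow> complex^'n \<Rightarrow> bool" where
  "constant_overlap F \<psi> \<longleftrightarrow> (\<exists>c. \<forall>\<sigma>\<in>F. cdot \<psi> (\<sigma> *v \<psi>) = c)"

end

theory Submission
  imports Defs
begin

text \<open>
  For the lower bounds, pull the target back through the two channels: \<open>Q = \<lambda> \<Lambda>\<^sup>\<dagger>(\<psi>)\<close>, with \<open>\<psi>\<close> the
  target pure state, satisfies \<open>Tr Q \<sigma> = \<lambda> Tr \<psi> \<Lambda>(\<sigma>)\<close>, which the resource fidelity bounds for free
  \<open>\<sigma>\<close>; since \<open>\<lambda>\<^sub>+ \<Lambda>\<^sub>+(\<rho>) - \<lambda>\<^sub>- \<Lambda>\<^sub>-(\<rho>) - \<psi>\<close> is traceless, its expectation in \<open>\<psi>\<close> is at least minus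
  half its trace norm.  For the upper bounds, measure the effect \<open>Q/\<mu>\<close> and prepare \<open>\<psi>\<close> or a state \<open>\<omega>\<close>
  that is optimal for the robustness.  The first outcome is so improbable on free states that the
  output remains free.
\<close>

subsection \<open>The complex inner product\<close>

text \<open>Both programs are handled at once through a relation \<open>R\<close>, which is
  \<open>(\<le>)\<close> for \<open>zeta_s\<close> and \<open>(=)\<close> for \<open>zeta_g\<close>.
  They part ways only where a measure-and-prepare map must send free states to free states. If the
  first outcome has probability exactly 1/k on free states, the output is the optimal mixture from
  the robustness itself, and the noise may be any state. If the probability is only at most 1/k, the
  output is that mixture diluted with more noise, so the noise must be free for convexity to apply.
  This is why inequalities go with the standard robustness and equalities with the generalized one.
  Because k is the robustness plus 1 exactly, an almost optimal noise state would not do: the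
  infimum must be attained, which requires compactness of the set of density operators. The lower
  bound does not lose a factor of two because the eigenvalues of a traceless hermitian matrix sum to
  0, so that its negative part carries half of the trace norm.\<close>

lemma cdot_add_left: "cdot (x + y) z = cdot x z + cdot y z"
  by (simp add: cdot_def algebra_simps sum.distrib)

lemma cdot_add_right: "cdot x (y + z) = cdot x y + cdot x z"
  by (simp add: cdot_def algebra_simps sum.distrib)

lemma cdot_diff_right: "cdot x (y - z) = cdot x y - cdot x z"
  by (simp add: cdot_def algebra_simps sum_subtractf)

lemma cdot_scale_left: "cdot (c *s x) y = cnj c * cdot x y"
  by (simp add: cdot_def sum_distrib_left mult.assoc)

lemma cdot_scale_right: "cdot x (c *s y) = c * cdot x y"
  by (simp add: cdot_def sum_distrib_left mult.left_commute)

lemma cdot_scaleR_right: "cdot x (r *\<^sub>R y) = of_real r * cdot x y"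
  by (simp add: cdot_def sum_distrib_left mult.left_commute scaleR_conv_of_real[where 'a=complex])

lemma cdot_zero_right [simp]: "cdot x 0 = 0"
  by (simp add: cdot_def)

lemma cdot_sum_right: "cdot x (\<Sum>i\<in>I. f i) = (\<Sum>i\<in>I. cdot x (f i))"
  by (induction I rule: infinite_finite_induct) (simp_all add: cdot_add_right)

lemma cdot_commute: "cdot y x = cnj (cdot x y)"
  by (simp add: cdot_def mult.commute)

lemma Re_cdot: "Re (cdot x y) = x \<bullet> y"
  by (simp add: cdot_def inner_vec_def inner_complex_def)

lemma cdot_self: "cdot x x = of_real ((norm x)\<^sup>2)"
proof (rule complex_eqI)
  show "Re (cdot x x) = Re (of_real ((norm x)\<^sup>2))"
    by (simp add: Re_cdot power2_norm_eq_inner)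
  have "Im (cnj z * z) = 0" for z
    by simp
  then show "Im (cdot x x) = Im (of_real ((norm x)\<^sup>2))"
    by (simp only: cdot_def Im_sum sum.neutral_const Im_complex_of_real)
qed

lemma cdot_mult_commute: "cdot x y * cdot y x = of_real ((cmod (cdot x y))\<^sup>2)"
  by (subst (2) cdot_commute) (simp only: complex_norm_square)

lemma cdot_axis: "cdot (axis i 1) x = x $ i"
proof -
  have "cdot (axis i 1) x = (\<Sum>j\<in>UNIV. if j = i then x $ j else 0)"
    unfolding cdot_def by (intro sum.cong) (auto simp: axis_def)
  then show ?thesis by simp
qed

lemma cdot_dagger: "cdot x (A *v y) = cdot (dagger A *v x) y"
proof -
  have "cdot x (A *v y) = (\<Sum>i\<in>UNIV. \<Sum>j\<in>UNIV. cnj (x $ i) * (A $ i $ j * y $ j))"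
    by (simp add: cdot_def matrix_vector_mult_def sum_distrib_left)
  also have "\<dots> = (\<Sum>j\<in>UNIV. \<Sum>i\<in>UNIV. cnj (x $ i) * (A $ i $ j * y $ j))"
    by (rule sum.swap)
  also have "\<dots> = cdot (dagger A *v x) y"
    by (simp add: cdot_def matrix_vector_mult_def dagger_def sum_distrib_left sum_distrib_right
        algebra_simps)
  finally show ?thesis .
qed

subsection \<open>Matrices\<close>

lemma scaleR_matrix_mult_vec: "(r *\<^sub>R A) *v x = r *\<^sub>R (A *v x)" for A :: "complex^'n^'m"
  by (simp add: vec_eq_iff matrix_vector_mult_def scaleR_sum_right)

lemma matrix_mult_vec_scaleR: "A *v (r *\<^sub>R x) = r *\<^sub>R (A *v x)" for A :: "complex^'n^'m"
  by (simp add: vec_eq_iff matrix_vector_mult_def scaleR_sum_right)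

lemma cscale_matrix_mult_vec: "matrix_cscale c A *v x = c *s (A *v x)"
  by (simp add: vec_eq_iff matrix_vector_mult_def matrix_cscale_def sum_distrib_left mult.assoc)

lemma matrix_cscale_of_real: "matrix_cscale (of_real r) A = r *\<^sub>R A"
  by (simp add: vec_eq_iff matrix_cscale_def scaleR_conv_of_real[where 'a=complex])

lemma sum_matrix_mult_vec: "(\<Sum>i\<in>I. f i) *v x = (\<Sum>i\<in>I. f i *v x)" for f :: "_ \<Rightarrow> complex^'n^'m"
  by (induction I rule: infinite_finite_induct)
    (simp_all add: matrix_vector_mult_add_rdistrib)

lemma ketbra_mult_vec: "ketbra b *v x = cdot b x *s b"
  by (simp add: vec_eq_iff matrix_vector_mult_def ketbra_def cdot_def sum_distrib_left mult_ac)

lemma trace_mult_ketbra: "trace (A ** ketbra v) = cdot v (A *v v)"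
  by (simp add: trace_def matrix_matrix_mult_def ketbra_def cdot_def matrix_vector_mult_def
      sum_distrib_left mult_ac)

lemma trace_scaleR: "trace (r *\<^sub>R A) = of_real r * trace A" for A :: "complex^'n^'n"
  by (simp add: trace_def scaleR_conv_of_real[where 'a=complex] sum_distrib_left)

lemma trace_cscale: "trace (matrix_cscale c A) = c * trace A"
  by (simp add: trace_def matrix_cscale_def sum_distrib_left)

lemma trace_sum: "trace (\<Sum>i\<in>I. f i) = (\<Sum>i\<in>I. trace (f i))" for f :: "_ \<Rightarrow> complex^'n^'n"
  by (induction I rule: infinite_finite_induct) (simp_all add: trace_add trace_def[of 0])

lemma scaleR_matrix_mult: "(r *\<^sub>R A) ** B = r *\<^sub>R (A ** B)" for A :: "complex^'n^'m"
  by (simp add: vec_eq_iff matrix_matrix_mult_def scaleR_sum_right)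

lemma matrix_mult_scaleR: "A ** (r *\<^sub>R B) = r *\<^sub>R (A ** B)" for A :: "complex^'n^'m"
  by (simp add: vec_eq_iff matrix_matrix_mult_def scaleR_sum_right)

lemma matrix_mult_cscale: "A ** matrix_cscale c B = matrix_cscale c (A ** B)"
  by (simp add: vec_eq_iff matrix_matrix_mult_def matrix_cscale_def sum_distrib_left mult_ac)

lemma matrix_mult_sum: "A ** (\<Sum>i\<in>I. f i) = (\<Sum>i\<in>I. A ** f i)"
  for A :: "complex^'n^'m" and f :: "_ \<Rightarrow> complex^'k^'n"
  by (induction I rule: infinite_finite_induct) (simp_all add: matrix_add_ldistrib)

lemma matrix_diff_mult: "(A - B) ** C = A ** C - B ** C" for A B :: "complex^'n^'m"
  by (simp add: vec_eq_iff matrix_matrix_mult_def algebra_simps sum_subtractf)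

lemma matrix_add_mult: "(A + B) ** C = A ** C + B ** C" for A B :: "complex^'n^'m"
  by (simp add: vec_eq_iff matrix_matrix_mult_def algebra_simps sum.distrib)

lemma power2_norm_vec: "(norm v)\<^sup>2 = (\<Sum>i\<in>UNIV. (norm (v $ i))\<^sup>2)"
  for v :: "'b::real_normed_vector^'n"
  by (simp add: norm_vec_def L2_set_def sum_nonneg)

text \<open>The norm of a matrix as a nested \<open>vec\<close> is the Frobenius norm. Rank-one
  projectors thus have norm 1, which later bounds the set of density operators.\<close>

lemma norm_ketbra: "norm (ketbra v) = (norm v)\<^sup>2"
proof -
  have "(norm (ketbra v))\<^sup>2 = (\<Sum>i\<in>UNIV. \<Sum>j\<in>UNIV. (cmod (v $ i))\<^sup>2 * (cmod (v $ j))\<^sup>2)"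
    by (simp add: power2_norm_vec ketbra_def norm_mult power_mult_distrib)
  also have "\<dots> = ((norm v)\<^sup>2)\<^sup>2"
    unfolding power2_norm_vec[of v] by (simp add: power2_eq_square sum_product)
  finally show ?thesis
    by (simp only: power2_eq_iff_nonneg norm_ge_zero zero_le_power2)
qed

lemma trace_ketbra: "trace (ketbra v) = of_real ((norm v)\<^sup>2)"
  using trace_mult_ketbra[of "mat 1" v] by (simp add: cdot_self)

lemma hermitian_cdot: "hermitian A \<Longrightarrow> cdot x (A *v y) = cdot (A *v x) y"
  by (simp add: cdot_dagger hermitian_def)

lemma hermitianI:
  assumes "\<And>x y. cdot x (A *v y) = cdot (A *v x) y"
  shows "hermitian A"
proof -
  have "cnj (A $ j $ i) = A $ i $ j" for i j
  proof -
    have entry: "cdot (axis i 1) (A *v axis j 1) = A $ i $ j" for i j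
    proof -
      have "(A *v axis j 1) $ i = (\<Sum>k\<in>UNIV. if k = j then A $ i $ k else 0)"
        unfolding matrix_vector_mult_def vec_lambda_beta
        by (intro sum.cong) (auto simp: axis_def)
      then show ?thesis by (simp add: cdot_axis)
    qed
    have "A $ i $ j = cdot (axis i 1) (A *v axis j 1)"
      by (simp add: entry)
    also have "\<dots> = cnj (cdot (axis j 1) (A *v axis i 1))"
      by (subst assms) (rule cdot_commute)
    also have "\<dots> = cnj (A $ j $ i)"
      by (simp add: entry)
    finally show ?thesis by (rule sym)
  qed
  then show ?thesis
    by (simp add: hermitian_def dagger_def vec_eq_iff)
qed

lemma hermitian_diff: "hermitian A \<Longrightarrow> hermitian B \<Longrightarrow> hermitian (A - B)"
  by (simp add: hermitian_def dagger_def vec_eq_iff)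

lemma hermitian_scaleR: "hermitian A \<Longrightarrow> hermitian (r *\<^sub>R A)"
  by (simp add: hermitian_def dagger_def vec_eq_iff scaleR_conv_of_real[where 'a=complex])

subsection \<open>Positive semidefinite matrices\<close>

lemma psd_Re: "psd A \<Longrightarrow> 0 \<le> Re (cdot v (A *v v))"
  unfolding psd_def by (metis complex_nonneg_Reals_iff)

lemma psd_of_real_Re: "psd A \<Longrightarrow> cdot v (A *v v) = of_real (Re (cdot v (A *v v)))"
  unfolding psd_def by (intro complex_eqI) (auto simp: complex_nonneg_Reals_iff)

text \<open>Polarisation: realness of the form at \<open>x + y\<close> makes the imaginary parts of
  the two cross terms opposite, and realness at \<open>x + i y\<close> makes their real parts
  equal.\<close>

lemma psd_hermitian:
  assumes "psd A"
  shows "hermitian A"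
proof (rule hermitianI)
  fix x y
  define f where "f x y = cdot x (A *v y)" for x y
  have real: "Im (f v v) = 0" for v
    using assms unfolding psd_def f_def by (metis complex_nonneg_Reals_iff)
  have "f (x + y) (x + y) = f x x + f y y + (f x y + f y x)"
    by (simp add: f_def cdot_add_left cdot_add_right matrix_vector_right_distrib)
  then have 1: "Im (f x y) + Im (f y x) = 0"
    using real[of x] real[of y] real[of "x + y"] by simp
  have "f (x + \<i> *s y) (x + \<i> *s y) = f x x + f y y + \<i> * (f x y - f y x)"
    by (simp add: f_def cdot_add_left cdot_add_right matrix_vector_right_distrib
        cdot_scale_left cdot_scale_right vector_scalar_commute algebra_simps)
  then have 2: "Re (f x y) = Re (f y x)"
    using real[of x] real[of y] real[of "x + \<i> *s y"] by simp
  have "f x y = cnj (f y x)"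
    using 1 2 by (simp add: complex_eq_iff)
  then show "cdot x (A *v y) = cdot (A *v x) y"
    unfolding f_def by (metis cdot_commute)
qed

lemma psdI:
  assumes "hermitian A" and "\<And>v. 0 \<le> Re (cdot v (A *v v))"
  shows "psd A"
  unfolding psd_def
proof
  fix v
  have "cdot v (A *v v) = cnj (cdot v (A *v v))"
    using hermitian_cdot[OF assms(1)] by (metis cdot_commute)
  then have "Im (cdot v (A *v v)) = 0"
    by (simp add: complex_eq_iff)
  then show "cdot v (A *v v) \<in> \<real>\<^sub>\<ge>\<^sub>0"
    using assms(2) by (simp add: complex_nonneg_Reals_iff)
qed

lemma psd_zero [simp]: "psd 0"
  by (simp add: psd_def)

lemma psd_add: "psd A \<Longrightarrow> psd B \<Longrightarrow> psd (A + B)"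
  by (simp add: psd_def matrix_vector_mult_add_rdistrib cdot_add_right nonneg_Reals_add_I)

lemma psd_sum: "(\<And>i. i \<in> I \<Longrightarrow> psd (f i)) \<Longrightarrow> psd (\<Sum>i\<in>I. f i)"
  by (induction I rule: infinite_finite_induct) (auto intro: psd_add)

lemma psd_scaleR: "0 \<le> r \<Longrightarrow> psd A \<Longrightarrow> psd (r *\<^sub>R A)"
  by (simp add: psd_def scaleR_matrix_mult_vec cdot_scaleR_right nonneg_Reals_mult_I)

lemma psd_ketbra: "psd (ketbra v)"
  unfolding psd_def ketbra_mult_vec cdot_scale_right cdot_mult_commute
  by (simp only: nonneg_Reals_of_real_iff) simp

lemma psd_mat_1: "psd (mat 1 :: complex^'n^'n)"
  unfolding psd_def by (simp only: matrix_vector_mul_lid cdot_self nonneg_Reals_of_real_iff) simp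

subsection \<open>Spectral decomposition and square roots\<close>

text \<open>The maximiser \<open>x\<close> of the Rayleigh quotient, with maximum \<open>M\<close>, minimises the nonnegative form
  of \<open>M - f\<close> on \<open>W\<close>, hence its gradient \<open>M x - f x\<close> vanishes.\<close>

lemma selfadjoint_eigenvector_exists:
  fixes f :: "'a::euclidean_space \<Rightarrow> 'a"
  assumes "linear f" and self: "\<And>x y. x \<bullet> f y = f x \<bullet> y"
    and W: "subspace W" "\<And>x. x \<in> W \<Longrightarrow> f x \<in> W" "w \<in> W" "w \<noteq> 0"
  obtains x l where "x \<in> W" "norm x = 1" "f x = l *\<^sub>R x"
proof -
  let ?S = "W \<inter> sphere 0 1"
  have comp: "compact ?S"
    by (simp add: closed_Int_compact closed_subspace W)
  have "(1 / norm w) *\<^sub>R w \<in> ?S"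
    using W by (auto simp: subspace_scale)
  then have ne: "?S \<noteq> {}" by blast
  have cont: "continuous_on ?S (\<lambda>x. x \<bullet> f x)"
    by (intro continuous_intros linear_continuous_on linear_linear[THEN iffD2] assms)
      (use assms in \<open>simp add: linear_conv_bounded_linear\<close>)
  obtain x where x: "x \<in> ?S" and max: "\<And>y. y \<in> ?S \<Longrightarrow> y \<bullet> f y \<le> x \<bullet> f x"
    using continuous_attains_sup[OF comp ne cont] by blast
  define M where "M = x \<bullet> f x"
  define g where "g y = M *\<^sub>R y - f y" for y
  have g_nonneg: "0 \<le> y \<bullet> g y" if "y \<in> W" for y
  proof (cases "y = 0")
    case True
    then show ?thesis by simp
  next
    case False
    have "(1 / norm y) *\<^sub>R y \<in> ?S"
      using False that W by (auto simp: subspace_scale)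
    from max[OF this] have "(y \<bullet> f y) / (norm y)\<^sup>2 \<le> M"
      by (simp add: M_def linear_scale[OF \<open>linear f\<close>] power2_eq_square)
    then have "y \<bullet> f y \<le> M * (norm y)\<^sup>2"
      using False by (simp add: divide_simps)
    then show ?thesis
      by (simp add: g_def inner_diff_right power2_norm_eq_inner)
  qed
  have xx: "x \<bullet> x = 1"
    using x by (simp add: norm_eq_1)
  have gx: "x \<bullet> g x = 0"
    using xx by (simp add: g_def inner_diff_right M_def)
  have gxW: "g x \<in> W"
    using x W by (auto simp: g_def subspace_scale subspace_diff)
  have lin: "g (x + t *\<^sub>R y) = g x + t *\<^sub>R g y" for t y
    using \<open>linear f\<close> by (simp add: g_def linear_add linear_scale algebra_simps)
  have sym: "x \<bullet> g y = g x \<bullet> y" for y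
    by (simp add: g_def inner_diff_right inner_diff_left self)
  have gx': "g x \<bullet> x = 0"
    using gx by (simp add: inner_commute)
  have "g x \<bullet> g x = 0"
  proof (rule ccontr)
    define a where "a = g x \<bullet> g x"
    define b where "b = g x \<bullet> g (g x)"
    assume "g x \<bullet> g x \<noteq> 0"
    then have a: "a > 0" by (simp add: a_def)
    have b: "b \<ge> 0" using g_nonneg[OF gxW] by (simp add: b_def)
    have q: "0 \<le> 2 * t * a + t\<^sup>2 * b" for t
    proof -
      have "x + t *\<^sub>R g x \<in> W"
        using x gxW W by (auto simp: subspace_add subspace_scale)
      from g_nonneg[OF this] show ?thesis
        by (simp add: lin inner_add_left inner_add_right gx gx' sym a_def b_def power2_eq_square
            algebra_simps)
    qed
    \<comment> \<open>The form of \<open>g\<close> at \<open>x + t g x\<close> is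
      \<open>2 t a + t^2 b\<close>, whose linear term dominates for small negative t. The choice t =
      -a/(b+1) makes it negative; adding 1 in the denominator covers \<open>b = 0\<close>.\<close>
    define c where "c = b + 1"
    define r where "r = a / c"
    have c: "c > 0" "b < 2 * c" "a = r * c" "r > 0"
      using a b by (simp_all add: c_def r_def)
    have "2 * (- r) * a + (- r)\<^sup>2 * b = r\<^sup>2 * (b - 2 * c)"
      unfolding c(3) by (simp add: power2_eq_square algebra_simps)
    also have "\<dots> < 0"
      using c by (intro mult_pos_neg) auto
    finally show False using q[of "- r"] by simp
  qed
  then have "f x = M *\<^sub>R x" by (simp add: g_def)
  with x show ?thesis by (intro that[of x M]) auto
qed

text \<open>Completeness is encoded as the resolution of the identity, from which expansions of
  vectors and of traces follow by multiplying with it.\<close>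

definition orthonormal_basis :: "(complex^'n) set \<Rightarrow> bool" where
  "orthonormal_basis B \<longleftrightarrow> finite B \<and> (\<forall>b\<in>B. \<forall>c\<in>B. cdot b c = (if b = c then 1 else 0))
     \<and> (\<Sum>b\<in>B. ketbra b) = mat 1"

text \<open>Take an orthonormal set of eigenvectors of largest size. Its orthogonal complement
  \<open>W\<close> is invariant under \<open>A\<close>, so a nonzero vector in it would produce one
  more eigenvector, contradicting maximality.\<close>

lemma hermitian_eigenbasis:
  fixes A :: "complex^'n^'n"
  assumes A: "hermitian A"
  obtains B l where "orthonormal_basis B" "\<And>b. b \<in> B \<Longrightarrow> A *v b = l b *\<^sub>R b"
proof -
  define P where "P B \<longleftrightarrow> finite B \<and> (\<forall>b\<in>B. \<forall>c\<in>B. cdot b c = (if b = c then 1 else 0))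
      \<and> (\<forall>b\<in>B. \<exists>l. A *v b = l *\<^sub>R b)" for B :: "(complex^'n) set"
  \<comment> \<open>Complex orthogonality implies orthogonality for the real inner product, hence
    independence over the reals. The bound is therefore the real dimension, and its finiteness is
    what makes a largest set exist.\<close>
  have bound: "card B \<le> DIM(complex^'n)" if "P B" for B
  proof -
    have ind: "independent B"
    proof (rule pairwise_orthogonal_independent)
      show "pairwise orthogonal B"
        using that unfolding P_def pairwise_def orthogonal_def by (metis Re_cdot zero_complex.sel(1))
      show "0 \<notin> B"
        using that unfolding P_def by (metis cdot_zero_right zero_neq_one)
    qed
    then show ?thesis by (rule independent_bound[THEN conjunct2])
  qed
  have "P {}" by (simp add: P_def)
  moreover have "\<forall>B. P B \<longrightarrow> card B < Suc DIM(complex^'n)"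
    using bound by (simp add: less_Suc_eq_le)
  ultimately obtain B where B: "P B" and max: "\<And>C. P C \<Longrightarrow> card C \<le> card B"
    using ex_has_greatest_nat[of P "{}" card] by blast
  have B_fin: "finite B" and B_on: "\<And>b c. b \<in> B \<Longrightarrow> c \<in> B \<Longrightarrow> cdot b c = (if b = c then 1 else 0)"
    and B_eig: "\<And>b. b \<in> B \<Longrightarrow> \<exists>l. A *v b = l *\<^sub>R b"
    using B by (simp_all add: P_def)
  define W where "W = {x. \<forall>b\<in>B. cdot b x = 0}"
  have W: "subspace W"
    by (auto simp: W_def subspace_def cdot_add_right cdot_scaleR_right)
  have AW: "A *v x \<in> W" if "x \<in> W" for x
  proof -
    have "cdot b (A *v x) = 0" if "b \<in> B" for b
    proof -
      obtain l where "A *v b = l *\<^sub>R b"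
        using B_eig[OF \<open>b \<in> B\<close>] by blast
      then have "cdot b (A *v x) = cdot (l *\<^sub>R b) x"
        using hermitian_cdot[OF A] by metis
      also have "\<dots> = cnj (of_real l * cdot x b)"
        by (metis cdot_commute cdot_scaleR_right)
      also have "\<dots> = 0"
        using \<open>x \<in> W\<close> that by (subst cdot_commute) (simp add: W_def)
      finally show ?thesis .
    qed
    then show ?thesis by (simp add: W_def)
  qed
  have W0: "w = 0" if "w \<in> W" for w
  proof (rule ccontr)
    assume "w \<noteq> 0"
    have lin: "linear ((*v) A)"
      by (auto intro!: linearI simp: matrix_vector_right_distrib matrix_mult_vec_scaleR)
    \<comment> \<open>The real inner product is the real part of \<open>cdot\<close>, so
      \<open>A\<close> is selfadjoint for it and has a real eigenvalue on \<open>W\<close>.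
      Membership in \<open>W\<close> still makes the new eigenvector orthogonal to \<open>B\<close>
      in the complex sense.\<close>
    have self: "x \<bullet> (A *v y) = (A *v x) \<bullet> y" for x y
      using hermitian_cdot[OF A] by (metis Re_cdot)
    obtain x l where x: "x \<in> W" "norm x = 1" "A *v x = l *\<^sub>R x"
      using selfadjoint_eigenvector_exists[OF lin self W AW \<open>w \<in> W\<close> \<open>w \<noteq> 0\<close>] by blast
    have xx: "cdot x x = 1"
      using x by (simp add: cdot_self)
    have xB: "cdot b x = 0" "cdot x b = 0" if "b \<in> B" for b
      using x that cdot_commute[of x b] by (auto simp: W_def)
    then have "x \<notin> B"
      using xx by auto
    then have "P (insert x B)"
      using x(3) by (auto simp: P_def B_fin B_on B_eig xx xB)
    then have "card (insert x B) \<le> card B" by (rule max)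
    with \<open>x \<notin> B\<close> show False by (simp add: B_fin)
  qed
  have "(\<Sum>b\<in>B. ketbra b) *v x = x" for x
  proof -
    have "x - (\<Sum>b\<in>B. ketbra b) *v x \<in> W"
    proof -
      have "cdot c ((\<Sum>b\<in>B. ketbra b) *v x) = cdot c x" if "c \<in> B" for c
      proof -
        have "cdot c ((\<Sum>b\<in>B. ketbra b) *v x) = (\<Sum>b\<in>B. cdot b x * cdot c b)"
          unfolding sum_matrix_mult_vec ketbra_mult_vec cdot_sum_right cdot_scale_right ..
        also have "\<dots> = (\<Sum>b\<in>B. if b = c then cdot b x else 0)"
          using that by (intro sum.cong) (auto simp: B_on)
        also have "\<dots> = cdot c x"
          using that by (simp add: B_fin)
        finally show ?thesis .
      qed
      then show ?thesis by (simp add: W_def cdot_diff_right)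
    qed
    from W0[OF this] show ?thesis by simp
  qed
  then have "(\<Sum>b\<in>B. ketbra b) = mat 1"
    by (simp add: matrix_eq)
  then have "orthonormal_basis B"
    by (simp add: orthonormal_basis_def B_fin B_on)
  moreover obtain l where "\<And>b. b \<in> B \<Longrightarrow> A *v b = l b *\<^sub>R b"
    using B_eig by metis
  ultimately show ?thesis by (rule that)
qed

section \<open>Expansions of vectors, norms, traces and matrices in an orthonormal basis\<close>

lemma orthonormal_basis_vec:
  assumes "orthonormal_basis B"
  shows "x = (\<Sum>b\<in>B. cdot b x *s b)"
proof -
  have "x = (\<Sum>b\<in>B. ketbra b) *v x"
    using assms by (simp add: orthonormal_basis_def)
  then show ?thesis by (simp add: sum_matrix_mult_vec ketbra_mult_vec)
qed

lemma orthonormal_basis_parseval: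
  assumes "orthonormal_basis B"
  shows "(norm x)\<^sup>2 = (\<Sum>b\<in>B. (cmod (cdot b x))\<^sup>2)"
proof -
  have "complex_of_real ((norm x)\<^sup>2) = cdot x (\<Sum>b\<in>B. cdot b x *s b)"
    unfolding orthonormal_basis_vec[OF assms, of x, symmetric] cdot_self ..
  also have "\<dots> = of_real (\<Sum>b\<in>B. (cmod (cdot b x))\<^sup>2)"
    by (simp only: cdot_sum_right cdot_scale_right cdot_mult_commute of_real_sum)
  finally show ?thesis using of_real_eq_iff by blast
qed

lemma orthonormal_basis_norm:
  assumes "orthonormal_basis B" "b \<in> B"
  shows "norm b = 1"
proof -
  have "cdot b b = 1"
    using assms by (simp add: orthonormal_basis_def)
  then have "(norm b)\<^sup>2 = 1"
    unfolding cdot_self by (metis of_real_eq_1_iff)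
  then show ?thesis by (simp add: power2_eq_1_iff)
      (smt (verit) norm_ge_zero)
qed

lemma orthonormal_basis_coeff_le:
  assumes "orthonormal_basis B" "b \<in> B"
  shows "(cmod (cdot b x))\<^sup>2 \<le> (norm x)\<^sup>2"
  using assms unfolding orthonormal_basis_parseval[OF assms(1), of x]
  by (intro member_le_sum) (auto simp: orthonormal_basis_def)

lemma orthonormal_basis_trace:
  assumes "orthonormal_basis B"
  shows "trace A = (\<Sum>b\<in>B. cdot b (A *v b))"
proof -
  have "trace A = trace (A ** (\<Sum>b\<in>B. ketbra b))"
    using assms by (simp add: orthonormal_basis_def)
  then show ?thesis
    by (simp add: matrix_mult_sum trace_sum trace_mult_ketbra)
qed

lemma spectral_decomposition:
  assumes B: "orthonormal_basis B" and l: "\<And>b. b \<in> B \<Longrightarrow> A *v b = l b *\<^sub>R b"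
  shows "A = (\<Sum>b\<in>B. l b *\<^sub>R ketbra b)"
proof -
  have "A *v x = (\<Sum>b\<in>B. l b *\<^sub>R ketbra b) *v x" for x
  proof -
    have "A *v x = A *v (\<Sum>b\<in>B. cdot b x *s b)"
      using orthonormal_basis_vec[OF B] by metis
    also have "\<dots> = (\<Sum>b\<in>B. A *v (cdot b x *s b))"
      by (induction B rule: infinite_finite_induct) (simp_all add: matrix_vector_right_distrib)
    also have "\<dots> = (\<Sum>b\<in>B. l b *\<^sub>R ketbra b *v x)"
      by (intro sum.cong refl) (simp add: vector_scalar_commute l scaleR_matrix_mult_vec
          ketbra_mult_vec vec_eq_iff)
    finally show ?thesis by (simp add: sum_matrix_mult_vec)
  qed
  then show ?thesis by (simp add: matrix_eq)
qed

lemma spectral_sum_eigenvector: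
  assumes B: "orthonormal_basis B" and "c \<in> B"
  shows "(\<Sum>b\<in>B. l b *\<^sub>R ketbra b) *v c = l c *\<^sub>R c"
proof -
  have "(\<Sum>b\<in>B. l b *\<^sub>R ketbra b) *v c = (\<Sum>b\<in>B. l b *\<^sub>R (cdot b c *s b))"
    by (simp add: sum_matrix_mult_vec scaleR_matrix_mult_vec ketbra_mult_vec)
  also have "\<dots> = (\<Sum>b\<in>B. if b = c then l c *\<^sub>R c else 0)"
    using B \<open>c \<in> B\<close> unfolding orthonormal_basis_def by (intro sum.cong) auto
  also have "\<dots> = l c *\<^sub>R c"
    using B \<open>c \<in> B\<close> by (simp add: orthonormal_basis_def)
  finally show ?thesis .
qed

lemma psd_spectral_decomposition:
  assumes "psd A"
  obtains B l where "orthonormal_basis B" "\<And>b. b \<in> B \<Longrightarrow> 0 \<le> l b"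
    "A = (\<Sum>b\<in>B. l b *\<^sub>R ketbra b)"
proof -
  obtain B l where B: "orthonormal_basis B" and l: "\<And>b. b \<in> B \<Longrightarrow> A *v b = l b *\<^sub>R b"
    using hermitian_eigenbasis[OF psd_hermitian[OF assms]] by blast
  have "0 \<le> l b" if "b \<in> B" for b
    using psd_Re[OF assms, of b] l[OF that] orthonormal_basis_norm[OF B that]
    by (simp add: cdot_scaleR_right cdot_self)
  with B show ?thesis
    using spectral_decomposition[OF B l] by (intro that[of B l]) auto
qed

text \<open>This makes the description in \<open>psd_sqrt\<close> well defined. For a unit
  eigenvector x of A - B with eigenvalue l, let a and b be the expectations of A and B. Equality of
  the norms of Ax and Bx gives l(a + b) = 0, while a = l + b with a, b nonnegative; hence l =
  0.\<close>

lemma psd_sqrt_unique: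
  assumes A: "psd A" and B: "psd B" and eq: "A ** A = B ** B"
  shows "A = B"
proof -
  have "hermitian (A - B)"
    using A B by (intro hermitian_diff psd_hermitian)
  then obtain E l where E: "orthonormal_basis E"
    and l: "\<And>x. x \<in> E \<Longrightarrow> (A - B) *v x = l x *\<^sub>R x"
    using hermitian_eigenbasis by blast
  have "l x = 0" if "x \<in> E" for x
  proof -
    let ?a = "Re (cdot x (A *v x))" and ?b = "Re (cdot x (B *v x))"
    have n: "cdot x x = 1"
      using orthonormal_basis_norm[OF E that] by (simp add: cdot_self)
    have d: "A *v x = l x *\<^sub>R x + B *v x"
      using l[OF that] by (simp add: matrix_vector_mult_diff_rdistrib algebra_simps)
    have "cdot x (A *v (A *v x)) = cdot (A *v x) (A *v x)"
      by (rule hermitian_cdot[OF psd_hermitian[OF A]])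
    moreover have "cdot x (B *v (B *v x)) = cdot (B *v x) (B *v x)"
      by (rule hermitian_cdot[OF psd_hermitian[OF B]])
    ultimately have "(A *v x) \<bullet> (A *v x) = (B *v x) \<bullet> (B *v x)"
      using eq by (metis Re_cdot matrix_vector_mul_assoc)
    then have "l x * (?a + ?b) = 0"
      unfolding Re_cdot d by (simp add: inner_add_left inner_add_right inner_commute algebra_simps)
    moreover have "?a = l x + ?b"
      unfolding d by (simp add: cdot_add_right cdot_scaleR_right n)
    moreover have "0 \<le> ?a" "0 \<le> ?b"
      using A B by (auto intro: psd_Re)
    ultimately show ?thesis by auto
  qed
  then have "A - B = 0"
    using spectral_decomposition[OF E l] by simp
  then show ?thesis by simp
qed

lemma psd_sqrt_eqI: "psd B \<Longrightarrow> B ** B = A \<Longrightarrow> psd_sqrt A = B"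
  unfolding psd_sqrt_def by (rule the_equality) (auto intro: psd_sqrt_unique)

text \<open>Replacing each eigenvalue by its absolute value does not change the square, so the
  resulting positive matrix is the square root in the definition of the trace norm.\<close>

lemma trace_norm_spectral:
  assumes A: "hermitian A" and B: "orthonormal_basis B"
    and l: "\<And>b. b \<in> B \<Longrightarrow> A *v b = l b *\<^sub>R b"
  shows "trace_norm A = (\<Sum>b\<in>B. \<bar>l b\<bar>)"
proof -
  let ?P = "\<Sum>b\<in>B. \<bar>l b\<bar> *\<^sub>R ketbra b"
  have P: "?P *v b = \<bar>l b\<bar> *\<^sub>R b" if "b \<in> B" for b
    by (rule spectral_sum_eigenvector[OF B that])
  have "?P ** ?P = (\<Sum>b\<in>B. (l b)\<^sup>2 *\<^sub>R ketbra b)"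
    by (rule spectral_decomposition[OF B])
      (simp add: P matrix_mult_vec_scaleR power2_eq_square flip: matrix_vector_mul_assoc)
  also have "\<dots> = A ** A"
    by (rule spectral_decomposition[OF B, symmetric])
      (simp add: l matrix_mult_vec_scaleR power2_eq_square flip: matrix_vector_mul_assoc)
  also have "\<dots> = dagger A ** A"
    using A by (simp add: hermitian_def)
  finally have "psd_sqrt (dagger A ** A) = ?P"
    by (intro psd_sqrt_eqI psd_sum psd_scaleR psd_ketbra) auto
  then show ?thesis
    using orthonormal_basis_norm[OF B]
    by (simp add: trace_norm_def trace_sum trace_scaleR trace_ketbra)
qed

lemma sum_nonneg_Reals: "(\<And>i. i \<in> I \<Longrightarrow> f i \<in> \<real>\<^sub>\<ge>\<^sub>0) \<Longrightarrow> (\<Sum>i\<in>I. f i) \<in> \<real>\<^sub>\<ge>\<^sub>0"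
  for f :: "_ \<Rightarrow> complex"
  by (induction I rule: infinite_finite_induct) (auto intro: nonneg_Reals_add_I)

text \<open>Expanding \<open>B\<close> spectrally turns the trace into a nonnegative combination of
  values of the quadratic form of \<open>A\<close>.\<close>

lemma psd_trace_mult:
  assumes "psd A" "psd B"
  shows "trace (A ** B) \<in> \<real>\<^sub>\<ge>\<^sub>0"
proof -
  obtain E l where l: "\<And>b. b \<in> E \<Longrightarrow> 0 \<le> l b" and B: "B = (\<Sum>b\<in>E. l b *\<^sub>R ketbra b)"
    using psd_spectral_decomposition[OF assms(2)] by metis
  have "trace (A ** B) = (\<Sum>b\<in>E. of_real (l b) * cdot b (A *v b))"
    unfolding B by (simp add: matrix_mult_sum trace_sum matrix_mult_scaleR trace_scaleR
        trace_mult_ketbra)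
  also have "\<dots> \<in> \<real>\<^sub>\<ge>\<^sub>0"
    using \<open>psd A\<close> l unfolding psd_def by (intro sum_nonneg_Reals nonneg_Reals_mult_I) auto
  finally show ?thesis .
qed

text \<open>Used to bound a pulled-back effect by the identity and the fidelity by 1.\<close>

lemma psd_quadratic_form_le_trace:
  assumes "psd S"
  shows "Re (cdot x (S *v x)) \<le> (norm x)\<^sup>2 * Re (trace S)"
proof -
  obtain B l where B: "orthonormal_basis B" and l: "\<And>b. b \<in> B \<Longrightarrow> 0 \<le> l b"
    and S: "S = (\<Sum>b\<in>B. l b *\<^sub>R ketbra b)"
    using psd_spectral_decomposition[OF assms] by metis
  have "cdot x (S *v x) = (\<Sum>b\<in>B. of_real (l b * (cmod (cdot b x))\<^sup>2))"
    unfolding S sum_matrix_mult_vec scaleR_matrix_mult_vec ketbra_mult_vec cdot_sum_right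
      cdot_scaleR_right cdot_scale_right cdot_mult_commute of_real_mult ..
  then have "Re (cdot x (S *v x)) = (\<Sum>b\<in>B. l b * (cmod (cdot b x))\<^sup>2)"
    by (simp only: flip: of_real_sum) simp
  also have "\<dots> \<le> (\<Sum>b\<in>B. l b * (norm x)\<^sup>2)"
    by (intro sum_mono mult_left_mono l orthonormal_basis_coeff_le[OF B])
  also have "\<dots> = (norm x)\<^sup>2 * Re (trace S)"
    unfolding S using orthonormal_basis_norm[OF B]
    by (simp add: trace_sum trace_scaleR trace_ketbra sum_distrib_right mult.commute)
  finally show ?thesis .
qed

subsection \<open>Trace distance\<close>

lemma traceless_quadratic_form_le:
  assumes Y: "hermitian Y" "trace Y = 0" and x: "norm x = 1"
  shows "- Re (cdot x (Y *v x)) \<le> 1/2 * trace_norm Y"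
proof -
  obtain B l where B: "orthonormal_basis B" and l: "\<And>b. b \<in> B \<Longrightarrow> Y *v b = l b *\<^sub>R b"
    using hermitian_eigenbasis[OF Y(1)] by blast
  have S: "Y = (\<Sum>b\<in>B. l b *\<^sub>R ketbra b)"
    by (rule spectral_decomposition[OF B l])
  have "trace Y = of_real (\<Sum>b\<in>B. l b)"
    unfolding S using orthonormal_basis_norm[OF B]
    by (simp add: trace_sum trace_scaleR trace_ketbra)
  then have l0: "(\<Sum>b\<in>B. l b) = 0"
    using Y(2) by (metis of_real_eq_0_iff)
  have "cdot x (Y *v x) = (\<Sum>b\<in>B. of_real (l b * (cmod (cdot b x))\<^sup>2))"
    unfolding S sum_matrix_mult_vec scaleR_matrix_mult_vec ketbra_mult_vec cdot_sum_right
      cdot_scaleR_right cdot_scale_right cdot_mult_commute of_real_mult ..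
  then have "- Re (cdot x (Y *v x)) = (\<Sum>b\<in>B. - l b * (cmod (cdot b x))\<^sup>2)"
    by (simp only: flip: of_real_sum) (simp add: sum_negf)
  \<comment> \<open>The summand on the right is the negative part of the eigenvalue. Since the
    eigenvalues sum to 0, these parts add up to half of the trace norm.\<close>
  also have "\<dots> \<le> (\<Sum>b\<in>B. (\<bar>l b\<bar> - l b) / 2)"
  proof (rule sum_mono)
    fix b assume "b \<in> B"
    then have p: "(cmod (cdot b x))\<^sup>2 \<le> 1"
      using orthonormal_basis_coeff_le[OF B, of b x] x by simp
    have "- l b * (cmod (cdot b x))\<^sup>2 \<le> (\<bar>l b\<bar> - l b) / 2 * (cmod (cdot b x))\<^sup>2"
      by (intro mult_right_mono) auto
    also have "\<dots> \<le> (\<bar>l b\<bar> - l b) / 2"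
      using mult_left_mono[OF p, of "(\<bar>l b\<bar> - l b) / 2"] by simp
    finally show "- l b * (cmod (cdot b x))\<^sup>2 \<le> (\<bar>l b\<bar> - l b) / 2" .
  qed
  also have "\<dots> = 1/2 * trace_norm Y"
    by (simp add: trace_norm_spectral[OF Y(1) B l] sum_subtractf l0 flip: sum_divide_distrib)
  finally show ?thesis .
qed

lemma density_operatorD:
  assumes "density_operator A"
  shows "psd A" "trace A = 1" "hermitian A"
  using assms by (auto simp: density_operator_def intro: psd_hermitian)

text \<open>In an eigenbasis of the difference each eigenvalue is s times a difference of
  nonnegative diagonal entries of \<open>A\<close> and \<open>B\<close>. Its modulus is at most |s|
  times their sum, and these sums add up to two traces.\<close>

lemma trace_norm_scaled_density_difference:
  assumes A: "density_operator A" and B: "density_operator B"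
  shows "trace_norm (s *\<^sub>R (A - B)) \<le> 2 * \<bar>s\<bar>"
proof -
  let ?Y = "s *\<^sub>R (A - B)"
  note A = density_operatorD[OF A] and B = density_operatorD[OF B]
  have Y: "hermitian ?Y"
    by (intro hermitian_scaleR hermitian_diff A B)
  obtain E l where E: "orthonormal_basis E" and l: "\<And>b. b \<in> E \<Longrightarrow> ?Y *v b = l b *\<^sub>R b"
    using hermitian_eigenbasis[OF Y] by blast
  have tr: "(\<Sum>b\<in>E. Re (cdot b (C *v b))) = Re (trace C)" for C
    by (simp add: orthonormal_basis_trace[OF E, of C])
  have "trace_norm ?Y = (\<Sum>b\<in>E. \<bar>l b\<bar>)"
    by (rule trace_norm_spectral[OF Y E l])
  also have "\<dots> \<le> (\<Sum>b\<in>E. \<bar>s\<bar> * (Re (cdot b (A *v b)) + Re (cdot b (B *v b))))"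
  proof (rule sum_mono)
    fix b assume "b \<in> E"
    have "of_real (l b) = cdot b (?Y *v b)"
      using orthonormal_basis_norm[OF E \<open>b \<in> E\<close>]
      by (simp add: l[OF \<open>b \<in> E\<close>] cdot_scaleR_right cdot_self)
    also have "\<dots> = of_real s * (cdot b (A *v b) - cdot b (B *v b))"
      by (simp add: scaleR_matrix_mult_vec cdot_scaleR_right matrix_vector_mult_diff_rdistrib
          cdot_diff_right)
    finally have "l b = s * (Re (cdot b (A *v b)) - Re (cdot b (B *v b)))"
      by (simp add: complex_eq_iff)
    then show "\<bar>l b\<bar> \<le> \<bar>s\<bar> * (Re (cdot b (A *v b)) + Re (cdot b (B *v b)))"
      using psd_Re[OF A(1), of b] psd_Re[OF B(1), of b]
      by (simp add: abs_mult mult_left_mono)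
  qed
  also have "\<dots> = 2 * \<bar>s\<bar>"
    by (simp add: sum.distrib tr A B flip: sum_distrib_left)
  finally show ?thesis .
qed

subsection \<open>Completely positive maps\<close>

lemma block_psd_add:
  "block_psd n X \<Longrightarrow> block_psd n Y \<Longrightarrow> block_psd n (\<lambda>i j. X i j + Y i j)"
  by (simp add: block_psd_def matrix_vector_mult_add_rdistrib cdot_add_right sum.distrib
      nonneg_Reals_add_I)

lemma block_psd_scaleR:
  assumes "0 \<le> r" "block_psd n X"
  shows "block_psd n (\<lambda>i j. r *\<^sub>R X i j)"
  unfolding block_psd_def
proof
  fix v
  have "(\<Sum>i<n. \<Sum>j<n. cdot (v i) (r *\<^sub>R X i j *v v j))
      = of_real r * (\<Sum>i<n. \<Sum>j<n. cdot (v i) (X i j *v v j))"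
    by (simp add: scaleR_matrix_mult_vec cdot_scaleR_right sum_distrib_left)
  also have "\<dots> \<in> \<real>\<^sub>\<ge>\<^sub>0"
    using assms by (intro nonneg_Reals_mult_I) (auto simp: block_psd_def)
  finally show "(\<Sum>i<n. \<Sum>j<n. cdot (v i) (r *\<^sub>R X i j *v v j)) \<in> \<real>\<^sub>\<ge>\<^sub>0" .
qed

lemma block_psd_zero: "block_psd n (\<lambda>i j. 0)"
  by (simp add: block_psd_def)

lemma block_psd_1:
  fixes X :: "nat \<Rightarrow> nat \<Rightarrow> complex^'a^'a"
  shows "block_psd 1 X \<longleftrightarrow> psd (X 0 0)"
proof -
  have "(\<forall>v :: nat \<Rightarrow> complex^'a. P (v 0)) \<longleftrightarrow> (\<forall>x. P x)" for P
  proof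
    assume P: "\<forall>v :: nat \<Rightarrow> complex^'a. P (v 0)"
    show "\<forall>x. P x"
    proof
      fix x show "P x" using P[rule_format, of "\<lambda>_. x"] .
    qed
  qed simp
  then show ?thesis by (simp add: block_psd_def psd_def)
qed

lemma completely_positive_add:
  "completely_positive f \<Longrightarrow> completely_positive g \<Longrightarrow> completely_positive (\<lambda>X. f X + g X)"
  by (simp add: completely_positive_def block_psd_add)

lemma completely_positive_scaleR:
  "0 \<le> r \<Longrightarrow> completely_positive f \<Longrightarrow> completely_positive (\<lambda>X. r *\<^sub>R f X)"
  by (simp add: completely_positive_def block_psd_scaleR)

lemma completely_positive_sum:
  "(\<And>i. i \<in> I \<Longrightarrow> completely_positive (f i)) \<Longrightarrow> completely_positive (\<lambda>X. \<Sum>i\<in>I. f i X)"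
  by (induction I rule: infinite_finite_induct)
    (auto simp: completely_positive_add, auto simp: completely_positive_def block_psd_zero)

lemma completely_positive_psd:
  assumes "completely_positive \<Lambda>" "psd A"
  shows "psd (\<Lambda> A)"
proof -
  have "block_psd 1 (\<lambda>i j. \<Lambda> A)"
    using assms(1)[unfolded completely_positive_def, rule_format, of 1 "\<lambda>_ _. A"]
      assms(2) block_psd_1[of "\<lambda>_ _. A"] by blast
  then show ?thesis
    by (simp only: block_psd_1)
qed

text \<open>This is the map with the single Kraus operator |c><b|. In the proof \<open>?w\<close> is
  the family \<open>v\<close> transformed by the adjoint |b><c|, so the output form is the input
  form at \<open>?w\<close>.\<close>

lemma completely_positive_rank_one:
  fixes b :: "complex^'a" and c :: "complex^'b"
  shows
  "completely_positive (\<lambda>X. matrix_cscale (cdot b (X *v b)) (ketbra c))"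
  unfolding completely_positive_def
proof (intro allI impI)
  fix n and X :: "nat \<Rightarrow> nat \<Rightarrow> complex^'a^'a"
  assume X: "block_psd n X"
  show "block_psd n (\<lambda>i j. matrix_cscale (cdot b (X i j *v b)) (ketbra c))"
    unfolding block_psd_def
  proof
    fix v :: "nat \<Rightarrow> complex^'b"
    let ?w = "\<lambda>i. cdot c (v i) *s b"
    have "cdot (v i) (matrix_cscale (cdot b (X i j *v b)) (ketbra c) *v v j)
        = cdot (?w i) (X i j *v ?w j)" for i j :: nat
      by (simp add: cscale_matrix_mult_vec ketbra_mult_vec cdot_scale_right cdot_scale_left
          vector_scalar_commute cdot_commute[of "v i" c] mult_ac)
    then show "(\<Sum>i<n. \<Sum>j<n. cdot (v i) (matrix_cscale (cdot b (X i j *v b)) (ketbra c) *v v j))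
        \<in> \<real>\<^sub>\<ge>\<^sub>0"
      using X by (simp add: block_psd_def)
  qed
qed

text \<open>Spectral decompositions of both the effect and the prepared state write the map as a
  nonnegative combination of rank-one maps.\<close>

lemma completely_positive_measure_prepare:
  assumes "psd M" "psd S"
  shows "completely_positive (\<lambda>X. matrix_cscale (trace (M ** X)) S)"
proof -
  obtain B l where l: "\<And>b. b \<in> B \<Longrightarrow> 0 \<le> l b" and M: "M = (\<Sum>b\<in>B. l b *\<^sub>R ketbra b)"
    using psd_spectral_decomposition[OF assms(1)] by metis
  obtain C s where s: "\<And>c. c \<in> C \<Longrightarrow> 0 \<le> s c" and S: "S = (\<Sum>c\<in>C. s c *\<^sub>R ketbra c)"
    using psd_spectral_decomposition[OF assms(2)] by metis
  have tr: "trace (M ** X) = (\<Sum>b\<in>B. of_real (l b) * cdot b (X *v b))" for X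
    by (subst trace_mul_sym)
      (simp add: M matrix_mult_sum trace_sum matrix_mult_scaleR trace_scaleR trace_mult_ketbra)
  have "matrix_cscale (trace (M ** X)) S
      = (\<Sum>b\<in>B. l b *\<^sub>R (\<Sum>c\<in>C. s c *\<^sub>R matrix_cscale (cdot b (X *v b)) (ketbra c)))" for X
    by (simp add: tr S vec_eq_iff matrix_cscale_def sum_distrib_left sum_distrib_right
        scaleR_sum_right scaleR_conv_of_real[where 'a=complex] mult_ac,
        intro allI, rule sum.swap)
  then have "(\<lambda>X. matrix_cscale (trace (M ** X)) S)
      = (\<lambda>X. \<Sum>b\<in>B. l b *\<^sub>R (\<Sum>c\<in>C. s c *\<^sub>R matrix_cscale (cdot b (X *v b)) (ketbra c)))"
    by (rule ext)
  then show ?thesis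
    using l s by (simp add: completely_positive_sum completely_positive_scaleR
        completely_positive_rank_one)
qed

section \<open>Two-outcome measure-and-prepare channels\<close>

definition measure_prepare ::
    "complex^'a^'a \<Rightarrow> complex^'b^'b \<Rightarrow> complex^'b^'b \<Rightarrow> complex^'a^'a \<Rightarrow> complex^'b^'b" where
  "measure_prepare M S S' X =
     matrix_cscale (trace (M ** X)) S + matrix_cscale (trace ((mat 1 - M) ** X)) S'"

lemma cptp_measure_prepare:
  assumes M: "psd M" "psd (mat 1 - M)" and S: "density_operator S" "density_operator S'"
  shows "cptp (measure_prepare M S S')"
  unfolding cptp_def
proof (intro conjI allI)
  show "completely_positive (measure_prepare M S S')"
    unfolding measure_prepare_def
    by (intro completely_positive_add completely_positive_measure_prepare M
        density_operatorD(1)[OF S(1)] density_operatorD(1)[OF S(2)])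
  show "trace (measure_prepare M S S' X) = trace X" for X
    by (simp add: measure_prepare_def trace_add trace_cscale density_operatorD[OF S(1)]
        density_operatorD[OF S(2)] matrix_diff_mult trace_sub)
  show "measure_prepare M S S' (X + Y) = measure_prepare M S S' X + measure_prepare M S S' Y"
    for X Y
    by (simp add: measure_prepare_def matrix_add_ldistrib trace_add)
      (simp add: vec_eq_iff matrix_cscale_def algebra_simps)
  show "measure_prepare M S S' (matrix_cscale c X) = matrix_cscale c (measure_prepare M S S' X)"
    for c X
    by (simp add: measure_prepare_def matrix_mult_cscale trace_cscale)
      (simp add: vec_eq_iff matrix_cscale_def algebra_simps)
qed

text \<open>On states the outcome probabilities are real, which turns the complex coefficients of
  the definition into the real weights that convexity arguments need.\<close>

lemma measure_prepare_density:
  assumes "psd M" "density_operator \<tau>"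
  shows "measure_prepare M S S' \<tau>
    = Re (trace (M ** \<tau>)) *\<^sub>R S + (1 - Re (trace (M ** \<tau>))) *\<^sub>R S'"
proof -
  have "trace (M ** \<tau>) \<in> \<real>\<^sub>\<ge>\<^sub>0"
    by (rule psd_trace_mult[OF assms(1) density_operatorD(1)[OF assms(2)]])
  then have 1: "trace (M ** \<tau>) = of_real (Re (trace (M ** \<tau>)))"
    by (auto simp: complex_nonneg_Reals_iff complex_eq_iff)
  have 2: "trace ((mat 1 - M) ** \<tau>) = of_real (1 - Re (trace (M ** \<tau>)))"
    using 1 density_operatorD(2)[OF assms(2)] by (simp add: matrix_diff_mult trace_sub)
  show ?thesis
    unfolding measure_prepare_def by (subst 1, subst 2) (simp only: matrix_cscale_of_real)
qed

section \<open>Pulling a projector back through a channel\<close>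

lemma linear_functional_trace:
  fixes g :: "complex^'a^'a \<Rightarrow> complex"
  assumes add: "\<And>A B. g (A + B) = g A + g B" and scale: "\<And>c A. g (matrix_cscale c A) = c * g A"
  obtains Q where "\<And>X. g X = trace (Q ** X)"
proof
  fix X :: "complex^'a^'a"
  define U where "U i j = ((\<chi> k l. if k = i \<and> l = j then 1 else 0) :: complex^'a^'a)" for i j
  \<comment> \<open>The indices are transposed because the trace pairs the entry (i, j) of
    \<open>Q\<close> with the entry (j, i) of \<open>X\<close>.\<close>
  define Q :: "complex^'a^'a" where "Q = (\<chi> i j. g (U j i))"
  have "g 0 = 0"
    using scale[of 0 0] by (simp add: matrix_cscale_def flip: zero_vec_def)
  then have sum: "g (\<Sum>i\<in>I. h i) = (\<Sum>i\<in>I. g (h i))" for h and I :: "'a set"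
    by (induction I rule: infinite_finite_induct) (simp_all add: add)
  have "X = (\<Sum>j\<in>UNIV. \<Sum>i\<in>UNIV. matrix_cscale (X $ j $ i) (U j i))"
  proof -
    have entry: "matrix_cscale (X $ j $ i) (U j i) $ k $ l
        = (if i = l then if j = k then X $ j $ i else 0 else 0)" for i j k l
      by (simp add: matrix_cscale_def U_def)
    have "(\<Sum>j\<in>UNIV. \<Sum>i\<in>UNIV. matrix_cscale (X $ j $ i) (U j i)) $ k $ l = X $ k $ l" for k l
      by (simp add: sum_component entry)
    then show ?thesis by (simp add: vec_eq_iff)
  qed
  then have "g X = g (\<Sum>j\<in>UNIV. \<Sum>i\<in>UNIV. matrix_cscale (X $ j $ i) (U j i))"
    by (rule arg_cong)
  also have "\<dots> = (\<Sum>j\<in>UNIV. \<Sum>i\<in>UNIV. X $ j $ i * g (U j i))"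
    by (simp add: sum scale)
  also have "\<dots> = (\<Sum>i\<in>UNIV. \<Sum>j\<in>UNIV. X $ j $ i * g (U j i))"
    by (rule sum.swap)
  also have "\<dots> = trace (Q ** X)"
    by (simp add: trace_def matrix_matrix_mult_def Q_def mult.commute)
  finally show "g X = trace ((\<chi> i j. g (\<chi> k l. if k = j \<and> l = i then 1 else 0)) ** X)"
    by (simp add: Q_def U_def)
qed

text \<open>\<open>Q\<close> is the adjoint channel applied to the projector on \<open>x\<close>,
  obtained by representing the functional X \<mapsto> <x|\<Lambda>(X)|x> as a trace. Tested on
  rank-one inputs, positivity of \<Lambda> gives 0 \<le> Q and preservation of the trace gives Q
  \<le> 1.\<close>

lemma cptp_adjoint_effect:
  assumes \<Lambda>: "cptp \<Lambda>" and x: "norm x = 1"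
  obtains Q where "psd Q" "psd (mat 1 - Q)" "\<And>X. trace (Q ** X) = cdot x (\<Lambda> X *v x)"
proof -
  obtain Q where Q: "\<And>X. cdot x (\<Lambda> X *v x) = trace (Q ** X)"
    using \<Lambda> linear_functional_trace[of "\<lambda>X. cdot x (\<Lambda> X *v x)"]
    by (auto simp: cptp_def matrix_vector_mult_add_rdistrib cdot_add_right
        cscale_matrix_mult_vec cdot_scale_right)
  have cp: "completely_positive \<Lambda>"
    using \<Lambda> by (simp add: cptp_def)
  have \<Lambda>v: "psd (\<Lambda> (ketbra v))" for v
    by (rule completely_positive_psd[OF cp psd_ketbra])
  have Qv: "cdot v (Q *v v) = cdot x (\<Lambda> (ketbra v) *v x)" for v
    by (simp add: Q trace_mult_ketbra)
  have "psd Q"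
    unfolding psd_def Qv using \<Lambda>v by (simp add: psd_def)
  moreover have "psd (mat 1 - Q)"
  proof (rule psdI)
    show "hermitian (mat 1 - Q)"
      using \<open>psd Q\<close> psd_mat_1 by (intro hermitian_diff psd_hermitian)
    fix v
    have "Re (cdot x (\<Lambda> (ketbra v) *v x)) \<le> Re (trace (\<Lambda> (ketbra v)))"
      using psd_quadratic_form_le_trace[OF \<Lambda>v, of x v] x by simp
    also have "\<dots> = Re (cdot v v)"
      using \<Lambda> by (simp add: cptp_def trace_ketbra cdot_self)
    finally show "0 \<le> Re (cdot v ((mat 1 - Q) *v v))"
      by (simp add: matrix_vector_mult_diff_rdistrib cdot_diff_right Qv)
  qed
  ultimately show ?thesis
    using Q by (intro that[of Q]) auto
qed

subsection \<open>Bounds in terms of a measurement program\<close>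

text \<open>Below, \<open>c\<close> stands for \<open>1/k\<close>, which is \<open>0\<close> if \<open>k = \<infinity>\<close>.\<close>

lemma zeta_program_le_overhead:
  fixes F :: "(complex^'a^'a) set" and G :: "(complex^'b^'b) set"
  assumes R: "R = (\<le>) \<or> R = (=)" and x: "norm x = 1" and \<rho>: "density_operator \<rho>"
    and k: "\<And>\<mu>. ereal \<mu> / k = ereal (\<mu> * c)"
    and overlap: "\<And>\<sigma>. \<sigma> \<in> G \<Longrightarrow> R (ereal (Re (cdot x (\<sigma> *v x)))) (ereal c)"
  shows "zeta_program R F \<epsilon> \<rho> k \<le> virtual_overhead (rng_operations F G) \<epsilon> \<rho> (ketbra x)"
  unfolding zeta_program_def virtual_overhead_def
\<comment> \<open>Each admissible pair of weights for the overhead is feasible, unchanged, for the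
  program. Comparing the sets of values also covers an infeasible overhead, whose value is
  \<infinity>.\<close>
proof (rule Inf_superset_mono, safe)
  fix lp lm \<Lambda>p \<Lambda>m
  assume nonneg: "0 \<le> lp" "0 \<le> lm" and diff: "lp - lm = 1"
    and ops: "\<Lambda>p \<in> rng_operations F G" "\<Lambda>m \<in> rng_operations F G"
    and close: "1/2 * trace_norm (lp *\<^sub>R \<Lambda>p \<rho> - lm *\<^sub>R \<Lambda>m \<rho> - ketbra x) \<le> \<epsilon>"
  have cp: "cptp \<Lambda>p" "cptp \<Lambda>m"
    using ops by (auto simp: rng_operations_def)
  obtain P where P: "psd P" "psd (mat 1 - P)" "\<And>X. trace (P ** X) = cdot x (\<Lambda>p X *v x)"
    using cptp_adjoint_effect[OF cp(1) x] by blast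
  obtain M where M: "psd M" "psd (mat 1 - M)" "\<And>X. trace (M ** X) = cdot x (\<Lambda>m X *v x)"
    using cptp_adjoint_effect[OF cp(2) x] by blast
  have feasible: "hermitian (l *\<^sub>R Q) \<and> loewner_le 0 (l *\<^sub>R Q) \<and> loewner_le (l *\<^sub>R Q) (l *\<^sub>R mat 1)
      \<and> (\<forall>\<sigma>\<in>F. R (ereal (Re (trace ((l *\<^sub>R Q) ** \<sigma>)))) (ereal l / k))"
    if l: "0 \<le> l" and Q: "psd Q" "psd (mat 1 - Q)" "\<And>X. trace (Q ** X) = cdot x (\<Lambda> X *v x)"
      and \<Lambda>: "\<Lambda> \<in> rng_operations F G" for l Q \<Lambda>
  proof (intro conjI ballI)
    show "hermitian (l *\<^sub>R Q)"
      by (intro hermitian_scaleR psd_hermitian Q)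
    show "loewner_le 0 (l *\<^sub>R Q)"
      using psd_scaleR[OF l Q(1)] by (simp add: loewner_le_def)
    show "loewner_le (l *\<^sub>R Q) (l *\<^sub>R mat 1)"
      using psd_scaleR[OF l Q(2)] by (simp add: loewner_le_def scaleR_diff_right)
    fix \<sigma> assume "\<sigma> \<in> F"
    then have "R (ereal (Re (cdot x (\<Lambda> \<sigma> *v x)))) (ereal c)"
      using \<Lambda> by (intro overlap) (auto simp: rng_operations_def)
    then show "R (ereal (Re (trace ((l *\<^sub>R Q) ** \<sigma>)))) (ereal l / k)"
      unfolding k using R l
      by (auto simp: scaleR_matrix_mult trace_scaleR Q(3) mult_left_mono)
  qed
  have herm: "hermitian (\<Lambda> \<rho>)" "trace (\<Lambda> \<rho>) = 1" if "cptp \<Lambda>" for \<Lambda> :: "complex^'a^'a \<Rightarrow> complex^'b^'b"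
  proof -
    have "completely_positive \<Lambda>" "trace (\<Lambda> \<rho>) = trace \<rho>"
      using that by (simp_all add: cptp_def)
    then show "hermitian (\<Lambda> \<rho>)" "trace (\<Lambda> \<rho>) = 1"
      using completely_positive_psd density_operatorD[OF \<rho>] by (auto intro: psd_hermitian)
  qed
  let ?Y = "lp *\<^sub>R \<Lambda>p \<rho> - lm *\<^sub>R \<Lambda>m \<rho> - ketbra x"
  have "hermitian ?Y"
    by (intro hermitian_diff hermitian_scaleR herm cp psd_hermitian psd_ketbra)
  moreover have "trace ?Y = of_real (lp - lm) - 1"
    by (simp add: trace_sub trace_scaleR herm cp trace_ketbra x)
  ultimately have "- Re (cdot x (?Y *v x)) \<le> \<epsilon>"
    using traceless_quadratic_form_le[of ?Y x] x close diff by simp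
  moreover have "Re (cdot x (?Y *v x)) = Re (trace (\<rho> ** (lp *\<^sub>R P - lm *\<^sub>R M))) - 1"
    by (subst trace_mul_sym)
      (simp add: matrix_diff_mult trace_sub scaleR_matrix_mult trace_scaleR P M
        matrix_vector_mult_diff_rdistrib cdot_diff_right scaleR_matrix_mult_vec cdot_scaleR_right
        ketbra_mult_vec cdot_scale_right cdot_self x)
  ultimately have "1 - \<epsilon> \<le> Re (trace (\<rho> ** (lp *\<^sub>R P - lm *\<^sub>R M)))"
    by linarith
  then show "\<exists>\<mu>p \<mu>m. ereal (lp + lm) = ereal (\<mu>p + \<mu>m) \<and>
      (\<exists>Qp Qm. hermitian Qp \<and> hermitian Qm \<and>
        loewner_le 0 Qp \<and> loewner_le Qp (\<mu>p *\<^sub>R mat 1) \<and>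
        loewner_le 0 Qm \<and> loewner_le Qm (\<mu>m *\<^sub>R mat 1) \<and>
        (\<forall>\<sigma>\<in>F. R (ereal (Re (trace (Qp ** \<sigma>)))) (ereal \<mu>p / k) \<and>
               R (ereal (Re (trace (Qm ** \<sigma>)))) (ereal \<mu>m / k)) \<and>
        \<mu>p - \<mu>m = 1 \<and> 1 - \<epsilon> \<le> Re (trace (\<rho> ** (Qp - Qm))))"
    using feasible[OF nonneg(1) P ops(1)] feasible[OF nonneg(2) M ops(2)] diff
    by (intro exI[of _ lp] exI[of _ lm] conjI exI[of _ "lp *\<^sub>R P"] exI[of _ "lm *\<^sub>R M"]) auto
qed

text \<open>For \<open>\<mu> = 0\<close> the constraints force \<open>Q\<close> to vanish on states, and any effect with the right
  overlap on free states will do.\<close>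

lemma normalised_effect:
  fixes F :: "(complex^'a^'a) set"
  assumes R: "R = (\<le>) \<or> R = (=)" and F: "\<And>\<sigma>. \<sigma> \<in> F \<Longrightarrow> density_operator \<sigma>"
    and \<rho>: "density_operator \<rho>" and c: "0 \<le> c" "c \<le> 1" and s: "0 \<le> s" "s \<le> 1"
    and Q: "psd Q" "psd (\<mu> *\<^sub>R mat 1 - Q)"
    and bound: "\<And>\<sigma>. \<sigma> \<in> F \<Longrightarrow> R (ereal (Re (trace (Q ** \<sigma>)))) (ereal (\<mu> * c))"
  obtains M where "0 \<le> \<mu>" "psd M" "psd (mat 1 - M)"
    "\<And>\<sigma>. \<sigma> \<in> F \<Longrightarrow> R (ereal (Re (trace (M ** \<sigma>)))) (ereal c)"
    "\<mu> * Re (trace (M ** \<rho>)) = s * Re (trace (Q ** \<rho>)) + (1 - s) * c * \<mu>"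
proof -
  \<comment> \<open>The program does not state 0 \<le> \<mu>; pairing both operator inequalities
    with the state \<rho> yields it.\<close>
  have "trace (Q ** \<rho>) \<in> \<real>\<^sub>\<ge>\<^sub>0" "trace ((\<mu> *\<^sub>R mat 1 - Q) ** \<rho>) \<in> \<real>\<^sub>\<ge>\<^sub>0"
    by (intro psd_trace_mult Q density_operatorD(1)[OF \<rho>])+
  then have Q\<rho>: "0 \<le> Re (trace (Q ** \<rho>))" "Re (trace (Q ** \<rho>)) \<le> \<mu>"
    by (simp_all add: complex_nonneg_Reals_iff matrix_diff_mult trace_sub scaleR_matrix_mult
        trace_scaleR density_operatorD[OF \<rho>])
  show ?thesis
  proof (cases "\<mu> = 0")
    case True
    have "mat 1 - c *\<^sub>R mat 1 = (1 - c) *\<^sub>R (mat 1 :: complex^'a^'a)"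
      by (simp add: scaleR_left_diff_distrib)
    with True show ?thesis
      using R Q\<rho> c F
      by (intro that[of "c *\<^sub>R mat 1"])
        (auto simp: scaleR_matrix_mult trace_scaleR density_operatorD intro: psd_scaleR psd_mat_1)
  next
    case False
    with Q\<rho> have \<mu>: "0 < \<mu>" by linarith
    \<comment> \<open>Every state gives \<open>c I\<close> the value \<open>c\<close>, so mixing it
      in with weight 1 - s respects the bound on free states for both choices of
      \<open>R\<close>.\<close>
    let ?M = "(s / \<mu>) *\<^sub>R Q + ((1 - s) * c) *\<^sub>R mat 1"
    have tr: "Re (trace (?M ** \<sigma>)) = s / \<mu> * Re (trace (Q ** \<sigma>)) + (1 - s) * c"
      if "density_operator \<sigma>" for \<sigma>
      by (simp add: matrix_add_mult trace_add scaleR_matrix_mult trace_scaleR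
          density_operatorD[OF that])
    have "mat 1 - ?M = (s / \<mu>) *\<^sub>R (\<mu> *\<^sub>R mat 1 - Q) + ((1 - s) * (1 - c)) *\<^sub>R mat 1"
      using \<mu> by (simp add: algebra_simps)
    also have "psd \<dots>"
      using \<mu> s c by (intro psd_add psd_scaleR psd_mat_1 Q) auto
    finally have "psd (mat 1 - ?M)" .
    moreover have "psd ?M"
      using \<mu> s c by (intro psd_add psd_scaleR psd_mat_1 Q) auto
    moreover have "R (ereal (Re (trace (?M ** \<sigma>)))) (ereal c)" if "\<sigma> \<in> F" for \<sigma>
    proof -
      have "R (ereal (s / \<mu> * Re (trace (Q ** \<sigma>)))) (ereal (s / \<mu> * (\<mu> * c)))"
        using bound[OF that] R \<mu> s mult_left_mono[of "Re (trace (Q ** \<sigma>))" "\<mu> * c" "s / \<mu>"] by auto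
      moreover have "s / \<mu> * (\<mu> * c) = s * c"
        using \<mu> by simp
      ultimately show ?thesis
        using R unfolding tr[OF F[OF that]] by (auto simp: algebra_simps)
    qed
    moreover have "\<mu> * Re (trace (?M ** \<rho>)) = s * Re (trace (Q ** \<rho>)) + (1 - s) * c * \<mu>"
      unfolding tr[OF \<rho>] using \<mu> by (simp add: algebra_simps)
    ultimately show ?thesis
      using \<mu> by (intro that[of ?M]) auto
  qed
qed

text \<open>The measure-and-prepare maps of the two effects produce \<open>t \<psi> + (1 - t) \<omega>\<close> with
  \<open>t = Tr \<rho> (Q\<^sub>+ - Q\<^sub>-)\<close>.  If \<open>t > 1\<close> this may be far from \<open>\<psi>\<close>, so \<open>Q\<^sub>\<plusminus>\<close> is first mixed with
  \<open>(\<mu>\<^sub>\<plusminus>/k) I\<close>, which preserves both kinds of constraints, to reach \<open>t = 1\<close>.\<close>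

lemma overhead_le_zeta_program:
  fixes F :: "(complex^'a^'a) set" and G :: "(complex^'b^'b) set"
  assumes R: "R = (\<le>) \<or> R = (=)" and F: "free_states F" and x: "norm x = 1"
    and \<rho>: "density_operator \<rho>" and \<omega>: "density_operator \<omega>" and \<epsilon>: "0 \<le> \<epsilon>"
    and k: "\<And>\<mu>. ereal \<mu> / k = ereal (\<mu> * c)" and c: "0 \<le> c" "c \<le> 1"
    and G: "\<And>q. 0 \<le> q \<Longrightarrow> q \<le> 1 \<Longrightarrow> R (ereal q) (ereal c) \<Longrightarrow> q *\<^sub>R ketbra x + (1 - q) *\<^sub>R \<omega> \<in> G"
  shows "virtual_overhead (rng_operations F G) \<epsilon> \<rho> (ketbra x) \<le> zeta_program R F \<epsilon> \<rho> k"
  unfolding zeta_program_def virtual_overhead_def k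
proof (rule Inf_superset_mono, safe)
  fix \<mu>p \<mu>m :: real and Qp Qm
  assume Q: "loewner_le 0 Qp" "loewner_le Qp (\<mu>p *\<^sub>R mat 1)"
      "loewner_le 0 Qm" "loewner_le Qm (\<mu>m *\<^sub>R mat 1)"
    and bound: "\<forall>\<sigma>\<in>F. R (ereal (Re (trace (Qp ** \<sigma>)))) (ereal (\<mu>p * c)) \<and>
                   R (ereal (Re (trace (Qm ** \<sigma>)))) (ereal (\<mu>m * c))"
    and diff: "\<mu>p - \<mu>m = 1" and t: "1 - \<epsilon> \<le> Re (trace (\<rho> ** (Qp - Qm)))"
  have FD: "\<And>\<sigma>. \<sigma> \<in> F \<Longrightarrow> density_operator \<sigma>"
    using F by (simp add: free_states_def)
  define t where "t = Re (trace (\<rho> ** (Qp - Qm)))"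
  have t_eq: "t = Re (trace (Qp ** \<rho>)) - Re (trace (Qm ** \<rho>))"
    unfolding t_def by (subst trace_mul_sym) (simp add: matrix_diff_mult trace_sub)
  \<comment> \<open>As \<mu>p - \<mu>m = 1, mixing with weight 1 - s turns the total weight t of
    \<psi> into s t + (1 - s) c. For t \<le> 1 no mixing is done and the error is 1 - t. For t > 1
    the value 1 lies between c and t, and \<open>u\<close> is the weight that hits it.\<close>
  obtain s where s: "0 \<le> s" "s \<le> 1" and st: "\<bar>s * t + (1 - s) * c - 1\<bar> \<le> \<epsilon>"
  proof (cases "t \<le> 1")
    case True
    then show ?thesis using t by (intro that[of 1]) (auto simp: t_def)
  next
    case False
    define u where "u = (1 - c) / (t - c)"
    have u: "0 \<le> u" "u \<le> 1" "u * (t - c) = 1 - c"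
      using False c by (auto simp: u_def)
    then have "u * t + (1 - u) * c = 1"
      by (simp add: algebra_simps)
    with u \<epsilon> show ?thesis
      by (intro that[of u]) auto
  qed
  obtain P where P: "0 \<le> \<mu>p" "psd P" "psd (mat 1 - P)"
    "\<And>\<sigma>. \<sigma> \<in> F \<Longrightarrow> R (ereal (Re (trace (P ** \<sigma>)))) (ereal c)"
    "\<mu>p * Re (trace (P ** \<rho>)) = s * Re (trace (Qp ** \<rho>)) + (1 - s) * c * \<mu>p"
    using normalised_effect[OF R FD \<rho> c s, where Q = Qp and \<mu> = \<mu>p] Q(1,2) bound
    by (auto simp: loewner_le_def)
  obtain M where M: "0 \<le> \<mu>m" "psd M" "psd (mat 1 - M)"
    "\<And>\<sigma>. \<sigma> \<in> F \<Longrightarrow> R (ereal (Re (trace (M ** \<sigma>)))) (ereal c)"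
    "\<mu>m * Re (trace (M ** \<rho>)) = s * Re (trace (Qm ** \<rho>)) + (1 - s) * c * \<mu>m"
    using normalised_effect[OF R FD \<rho> c s, where Q = Qm and \<mu> = \<mu>m] Q(3,4) bound
    by (auto simp: loewner_le_def)
  have T: "density_operator (ketbra x)"
    using x by (simp add: density_operator_def psd_ketbra trace_ketbra)
  have op: "measure_prepare N (ketbra x) \<omega> \<in> rng_operations F G"
    if N: "psd N" "psd (mat 1 - N)" "\<And>\<sigma>. \<sigma> \<in> F \<Longrightarrow> R (ereal (Re (trace (N ** \<sigma>)))) (ereal c)"
    for N
  proof -
    have "measure_prepare N (ketbra x) \<omega> \<sigma> \<in> G" if "\<sigma> \<in> F" for \<sigma>
    proof -
      have "trace (N ** \<sigma>) \<in> \<real>\<^sub>\<ge>\<^sub>0" "trace ((mat 1 - N) ** \<sigma>) \<in> \<real>\<^sub>\<ge>\<^sub>0"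
        by (intro psd_trace_mult N density_operatorD(1)[OF FD[OF that]])+
      then have "0 \<le> Re (trace (N ** \<sigma>))" "Re (trace (N ** \<sigma>)) \<le> 1"
        by (simp_all add: complex_nonneg_Reals_iff matrix_diff_mult trace_sub
            density_operatorD[OF FD[OF that]])
      then show ?thesis
        unfolding measure_prepare_density[OF N(1) FD[OF that]] using N(3)[OF that] by (rule G)
    qed
    then show ?thesis
      using cptp_measure_prepare[OF N(1,2) T \<omega>] by (simp add: rng_operations_def)
  qed
  let ?p = "Re (trace (P ** \<rho>))" and ?m = "Re (trace (M ** \<rho>))"
  define r where "r = s * t + (1 - s) * c - 1"
  have r: "\<mu>p * ?p - \<mu>m * ?m = r + 1"
    using diff unfolding P(5) M(5) t_eq r_def by (simp add: algebra_simps)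
  \<comment> \<open>The weights of the two prepared states sum to \<mu>p - \<mu>m = 1, so a surplus
    \<open>r\<close> on the target is a deficit \<open>r\<close> on \<omega>. The deviation from the
    target is thus a multiple of a difference of two states.\<close>
  have pm: "\<mu>p * (1 - ?p) - \<mu>m * (1 - ?m) = - r"
    using r diff by (simp add: algebra_simps)
  have "\<mu>p *\<^sub>R measure_prepare P (ketbra x) \<omega> \<rho>
        - \<mu>m *\<^sub>R measure_prepare M (ketbra x) \<omega> \<rho> - ketbra x
      = (\<mu>p * ?p - \<mu>m * ?m - 1) *\<^sub>R ketbra x + (\<mu>p * (1 - ?p) - \<mu>m * (1 - ?m)) *\<^sub>R \<omega>"
    unfolding measure_prepare_density[OF P(2) \<rho>] measure_prepare_density[OF M(2) \<rho>]
    by (simp add: algebra_simps)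
  also have "\<dots> = r *\<^sub>R (ketbra x - \<omega>)"
    unfolding r pm by (simp add: algebra_simps)
  finally have "trace_norm (\<mu>p *\<^sub>R measure_prepare P (ketbra x) \<omega> \<rho>
      - \<mu>m *\<^sub>R measure_prepare M (ketbra x) \<omega> \<rho> - ketbra x) \<le> 2 * \<bar>r\<bar>"
    using trace_norm_scaled_density_difference[OF T \<omega>, of r] by simp
  then have "1/2 * trace_norm (\<mu>p *\<^sub>R measure_prepare P (ketbra x) \<omega> \<rho>
      - \<mu>m *\<^sub>R measure_prepare M (ketbra x) \<omega> \<rho> - ketbra x) \<le> \<epsilon>"
    using st by (simp flip: r_def)
  then show "\<exists>lp lm. ereal (\<mu>p + \<mu>m) = ereal (lp + lm) \<and> 0 \<le> lp \<and> 0 \<le> lm \<and> lp - lm = 1 \<and>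
      (\<exists>\<Lambda>p\<in>rng_operations F G. \<exists>\<Lambda>m\<in>rng_operations F G.
        1/2 * trace_norm (lp *\<^sub>R \<Lambda>p \<rho> - lm *\<^sub>R \<Lambda>m \<rho> - ketbra x) \<le> \<epsilon>)"
    using op[OF P(2-4)] op[OF M(2-4)] P(1) M(1) diff by blast
qed

subsection \<open>Resource measures\<close>

text \<open>Positivity and unit trace are closed conditions. The triangle inequality over the
  rank-one spectral terms bounds the norm by the sum of the eigenvalues, which is the trace.\<close>

lemma compact_density_operators: "compact {A :: complex^'n^'n. density_operator A}"
proof -
  have cont: "continuous_on UNIV (\<lambda>A :: complex^'n^'n. cdot v (A *v v))" for v
    unfolding cdot_def matrix_vector_mult_def by (simp add: continuous_intros)
  have "closed {A :: complex^'n^'n. cdot v (A *v v) \<in> \<real>\<^sub>\<ge>\<^sub>0}" for v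
    using continuous_closed_vimage[OF closed_nonneg_Reals_complex, of "\<lambda>A. cdot v (A *v v)"] cont[of v]
    by (simp add: vimage_def continuous_on_eq_continuous_at)
  then have "closed (\<Inter>v. {A :: complex^'n^'n. cdot v (A *v v) \<in> \<real>\<^sub>\<ge>\<^sub>0})"
    by blast
  moreover have "continuous_on UNIV (\<lambda>A :: complex^'n^'n. trace A)"
    unfolding trace_def by (intro continuous_intros)
  then have "closed {A :: complex^'n^'n. trace A = 1}"
    by (intro closed_Collect_eq continuous_intros) auto
  moreover have "{A :: complex^'n^'n. density_operator A}
      = (\<Inter>v. {A. cdot v (A *v v) \<in> \<real>\<^sub>\<ge>\<^sub>0}) \<inter> {A. trace A = 1}"
    by (auto simp: density_operator_def psd_def)
  ultimately have "closed {A :: complex^'n^'n. density_operator A}"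
    by (simp add: closed_Int)
  moreover have "norm A \<le> 1" if D: "density_operator A" for A :: "complex^'n^'n"
  proof -
    obtain B l where B: "orthonormal_basis B" and l: "\<And>b. b \<in> B \<Longrightarrow> 0 \<le> l b"
      and A: "A = (\<Sum>b\<in>B. l b *\<^sub>R ketbra b)"
      using psd_spectral_decomposition[OF density_operatorD(1)[OF D]] by metis
    have "norm (ketbra b) \<le> 1" if "b \<in> B" for b
      using orthonormal_basis_norm[OF B that] by (simp add: norm_ketbra)
    then have "norm A \<le> (\<Sum>b\<in>B. l b)"
      unfolding A using l by (intro sum_norm_le) (simp add: mult_left_le)
    also have "\<dots> = Re (trace A)"
      unfolding A using orthonormal_basis_norm[OF B]
      by (simp add: trace_sum trace_scaleR trace_ketbra)
    finally show ?thesis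
      using density_operatorD(2)[OF D] by simp
  qed
  then have "bounded {A :: complex^'n^'n. density_operator A}"
    by (auto simp: bounded_iff)
  ultimately show ?thesis
    by (simp add: compact_eq_bounded_closed)
qed

lemma compact_free_states:
  assumes "free_states F"
  shows "compact F"
proof -
  have "F = {A. density_operator A} \<inter> F"
    using assms by (auto simp: free_states_def)
  then show ?thesis
    using compact_Int_closed[OF compact_density_operators, of F] assms
    by (simp add: free_states_def)
qed

text \<open>\<open>K\<close> is the set of admissible noise states: all density operators for the
  generalized robustness, the free states for the standard one.\<close>

lemma robustness_attained:
  fixes T :: "complex^'n^'n"
  assumes K: "compact K" and G: "closed G"
    and r: "r = Inf {ereal l | l. 0 \<le> l \<and> (\<exists>\<omega>\<in>K. (1 / (1 + l)) *\<^sub>R (T + l *\<^sub>R \<omega>) \<in> G)}"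
    and "r < \<infinity>"
  obtains l \<omega> where "r = ereal l" "0 \<le> l" "\<omega> \<in> K" "(1 / (1 + l)) *\<^sub>R (T + l *\<^sub>R \<omega>) \<in> G"
proof -
  define L where "L = {l. 0 \<le> l \<and> (\<exists>\<omega>\<in>K. (1 / (1 + l)) *\<^sub>R (T + l *\<^sub>R \<omega>) \<in> G)}"
  have r: "r = Inf (ereal ` L)"
    unfolding r L_def by (rule arg_cong[of _ _ Inf]) auto
  have "L \<noteq> {}"
    using \<open>r < \<infinity>\<close> unfolding r by (auto simp: top_ereal_def)
  then obtain l0 where l0: "l0 \<in> L" by blast
  \<comment> \<open>Cutting off at an admissible \<open>l0\<close> leaves a compact set of pairs
    without changing the infimum, and \<open>1 + l\<close> does not vanish there, so
    \<open>?g\<close> is continuous.\<close>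
  let ?g = "\<lambda>(l, \<omega>). (1 / (1 + l)) *\<^sub>R (T + l *\<^sub>R \<omega>)"
  let ?S = "({0..l0} \<times> K) \<inter> ?g -` G"
  have "continuous_on ({0..l0} \<times> K) ?g"
    unfolding case_prod_beta by (intro continuous_intros) auto
  then have "closedin (top_of_set ({0..l0} \<times> K)) ?S"
    using G by (rule continuous_closedin_preimage)
  then have "compact ?S"
    by (rule closedin_compact[OF compact_Times[OF compact_Icc K]])
  then have "compact (fst ` ?S)"
    by (intro compact_continuous_image continuous_intros)
  moreover have "fst ` ?S = L \<inter> {0..l0}"
    by (force simp: L_def)
  moreover have "l0 \<in> L \<inter> {0..l0}"
    using l0 by (auto simp: L_def)
  ultimately obtain l where l: "l \<in> L" "l \<le> l0" and min: "\<And>l'. l' \<in> L \<inter> {0..l0} \<Longrightarrow> l \<le> l'"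
    using compact_attains_inf[of "L \<inter> {0..l0}"] by (metis IntD1 IntD2 atLeastAtMost_iff empty_iff)
  have "l \<le> l'" if "l' \<in> L" for l'
    using min[of l'] l(2) that by (cases "l' \<le> l0") (auto simp: L_def)
  then have "r = ereal l"
    unfolding r using l(1) by (intro antisym Inf_lower Inf_greatest) auto
  then show ?thesis
    using l(1) that unfolding L_def by blast
qed

text \<open>A projector is its own square root and compresses \<sigma> to \<open>p\<close> times
  itself, with \<open>p\<close> the overlap. The root of this has trace \<open>sqrt p\<close>, which
  the definition squares.\<close>

lemma resource_fidelity_pure:
  assumes G: "free_states G" and x: "norm x = 1"
  shows "resource_fidelity G (ketbra x) = (SUP \<sigma>\<in>G. ereal (Re (cdot x (\<sigma> *v x))))"
  unfolding resource_fidelity_def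
proof (rule SUP_cong[OF refl])
  fix \<sigma> assume "\<sigma> \<in> G"
  then have \<sigma>: "psd \<sigma>"
    using G by (auto simp: free_states_def density_operator_def)
  define p where "p = Re (cdot x (\<sigma> *v x))"
  have p: "0 \<le> p" "cdot x (\<sigma> *v x) = of_real p"
    using psd_Re[OF \<sigma>] psd_of_real_Re[OF \<sigma>] by (simp_all add: p_def)
  have idem: "ketbra x ** ketbra x = ketbra x"
    by (simp add: matrix_eq ketbra_mult_vec cdot_scale_right cdot_self x flip: matrix_vector_mul_assoc)
  have sq: "psd_sqrt (ketbra x) = ketbra x"
    by (intro psd_sqrt_eqI psd_ketbra idem)
  have "ketbra x ** \<sigma> ** ketbra x = p *\<^sub>R ketbra x"
    unfolding matrix_eq
    by (simp add: ketbra_mult_vec cdot_scale_right vector_scalar_commute p scaleR_matrix_mult_vec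
        flip: matrix_vector_mul_assoc)
      (simp add: vec_eq_iff scaleR_conv_of_real[where 'a=complex])
  also have "\<dots> = (sqrt p *\<^sub>R ketbra x) ** (sqrt p *\<^sub>R ketbra x)"
    using p by (simp add: scaleR_matrix_mult matrix_mult_scaleR idem)
  finally have "psd_sqrt (ketbra x ** \<sigma> ** ketbra x) = sqrt p *\<^sub>R ketbra x"
    using p by (intro psd_sqrt_eqI psd_scaleR psd_ketbra) auto
  then show "ereal ((Re (trace (psd_sqrt (psd_sqrt (ketbra x) ** \<sigma> ** psd_sqrt (ketbra x)))))\<^sup>2)
      = ereal (Re (cdot x (\<sigma> *v x)))"
    using p(1) by (simp add: sq trace_scaleR trace_ketbra x flip: p_def)
qed

text \<open>Passing to a real number \<open>f\<close> lets 1/k be an ordinary real coefficient, also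
  when the fidelity is 0 and k infinite.\<close>

lemma resource_fidelity_pure_real:
  assumes G: "free_states G" and x: "norm x = 1"
  obtains f where "resource_fidelity G (ketbra x) = ereal f" "0 \<le> f"
    "\<And>\<sigma>. \<sigma> \<in> G \<Longrightarrow> Re (cdot x (\<sigma> *v x)) \<le> f"
proof -
  let ?F = "resource_fidelity G (ketbra x)"
  have le: "ereal (Re (cdot x (\<sigma> *v x))) \<le> ?F" if "\<sigma> \<in> G" for \<sigma>
    unfolding resource_fidelity_pure[OF assms] using that by (rule SUP_upper)
  obtain \<sigma> where \<sigma>: "\<sigma> \<in> G"
    using G by (auto simp: free_states_def)
  have D: "density_operator \<tau>" if "\<tau> \<in> G" for \<tau>
    using G that by (simp add: free_states_def)
  have "0 \<le> ?F"
    using le[OF \<sigma>] psd_Re[OF density_operatorD(1)[OF D[OF \<sigma>]], of x]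
    by (meson ereal_less_eq(5) order_trans)
  moreover have "?F \<le> 1"
    unfolding resource_fidelity_pure[OF assms]
  proof (rule SUP_least)
    fix \<tau> assume "\<tau> \<in> G"
    then show "ereal (Re (cdot x (\<tau> *v x))) \<le> 1"
      using psd_quadratic_form_le_trace[of \<tau> x] density_operatorD[OF D] x by simp
  qed
  ultimately obtain f where "?F = ereal f" "0 \<le> f"
    by (cases ?F) auto
  with le show ?thesis
    by (intro that[of f]) auto
qed

text \<open>At \<open>f = 0\<close> the conventions 1/0 = \<infinity> and \<mu>/\<infinity> = 0 make
  both sides vanish.\<close>

lemma ereal_divide_inverse:
  assumes "0 \<le> f"
  shows "ereal \<mu> / inverse (ereal f) = ereal (\<mu> * f)"
  using assms by (cases "f = 0") (auto simp: divide_ereal_def)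

lemma ereal_divide_robustness:
  assumes "0 \<le> l"
  shows "ereal \<mu> / (ereal l + 1) = ereal (\<mu> * (1 / (1 + l)))"
  using assms by (simp add: one_ereal_def add.commute)

text \<open>Distributivity turns the sum over all index families into a product with one factor, the
  squared norm of \<open>x\<close>, for each copy.\<close>

lemma norm_tensor_power:
  fixes x :: "complex^'n"
  assumes "norm x = 1"
  shows "norm (tensor_power x :: complex^('m::finite \<Rightarrow> 'n)) = 1"
proof -
  let ?y = "tensor_power x :: complex^('m \<Rightarrow> 'n)"
  have "cdot ?y ?y = (\<Sum>f\<in>(UNIV::('m \<Rightarrow> 'n) set). \<Prod>i\<in>UNIV. cnj (x $ f i) * x $ f i)"
    by (simp add: cdot_def tensor_power_def prod.distrib)
  also have "\<dots> = (\<Prod>i\<in>(UNIV::'m set). \<Sum>j\<in>UNIV. cnj (x $ j) * x $ j)"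
    using prod_sum_PiE[of "UNIV::'m set" "\<lambda>_. UNIV::'n set" "\<lambda>i j. cnj (x $ j) * x $ j"]
    by simp
  also have "\<dots> = 1"
    using cdot_self[of x] assms by (simp add: cdot_def)
  finally have "(norm ?y)\<^sup>2 = 1"
    unfolding cdot_self by (metis of_real_eq_1_iff)
  then show ?thesis
    by (simp add: power2_eq_1_iff) (smt (verit) norm_ge_zero)
qed

text \<open>Infinite robustness means \<open>k = \<infinity>\<close>, so the measured effects vanish on free states and any
  free state can be prepared in place of the noise.\<close>

lemma overhead_le_zeta_program_robustness:
  fixes F :: "(complex^'a^'a) set" and G K :: "(complex^'b^'b) set"
  assumes R: "R = (\<le>) \<or> R = (=)" and F: "free_states F" and G: "free_states G" and x: "norm x = 1"
    and \<rho>: "density_operator \<rho>" and \<epsilon>: "0 \<le> \<epsilon>"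
    and K: "compact K" "\<And>\<omega>. \<omega> \<in> K \<Longrightarrow> density_operator \<omega>" and KG: "R = (=) \<or> K \<subseteq> G"
    and r: "r = Inf {ereal l | l. 0 \<le> l \<and> (\<exists>\<omega>\<in>K. (1 / (1 + l)) *\<^sub>R (ketbra x + l *\<^sub>R \<omega>) \<in> G)}"
  shows "virtual_overhead (rng_operations F G) \<epsilon> \<rho> (ketbra x) \<le> zeta_program R F \<epsilon> \<rho> (r + 1)"
proof (cases "r = \<infinity>")
  case True
  obtain \<omega> where \<omega>: "\<omega> \<in> G"
    using G by (auto simp: free_states_def)
  then have "density_operator \<omega>"
    using G by (simp add: free_states_def)
  moreover have "q *\<^sub>R ketbra x + (1 - q) *\<^sub>R \<omega> \<in> G" if "0 \<le> q" "R (ereal q) (ereal 0)" for q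
  proof -
    have "q = 0" using that R by auto
    then show ?thesis using \<omega> by simp
  qed
  ultimately show ?thesis
    using True by (intro overhead_le_zeta_program[OF R F x \<rho> _ \<epsilon>, of \<omega> _ 0]) auto
next
  case False
  then have "r < \<infinity>" by simp
  obtain l \<omega> where l: "r = ereal l" "0 \<le> l" and \<omega>: "\<omega> \<in> K"
    and mix: "(1 / (1 + l)) *\<^sub>R (ketbra x + l *\<^sub>R \<omega>) \<in> G"
    using robustness_attained[OF K(1) _ r \<open>r < \<infinity>\<close>] G by (metis free_states_def)
  let ?c = "1 / (1 + l)"
  have "q *\<^sub>R ketbra x + (1 - q) *\<^sub>R \<omega> \<in> G" if q: "0 \<le> q" "q \<le> 1" "R (ereal q) (ereal ?c)" for q
  proof -
    \<comment> \<open>\<open>u\<close> is the ratio of q to 1/(1 + l): the share of the optimal free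
      mixture that supplies weight q on the target, the rest being noise. For \<open>R = (=)\<close>
      the share is 1.\<close>
    define u where "u = q * (1 + l)"
    have q_eq: "q = u * ?c" and ul: "u * ?c * l + (1 - u) = 1 - q"
      using l by (simp_all add: u_def field_simps)
    have u: "0 \<le> u" "u \<le> 1"
      using q l R by (auto simp: u_def field_simps)
    have eq: "q *\<^sub>R ketbra x + (1 - q) *\<^sub>R \<omega> = u *\<^sub>R (?c *\<^sub>R (ketbra x + l *\<^sub>R \<omega>)) + (1 - u) *\<^sub>R \<omega>"
      unfolding ul[symmetric] by (subst q_eq) (simp only: scaleR_right_distrib scaleR_left_distrib
        scaleR_scaleR add.assoc mult.assoc)
    show ?thesis
    proof (cases "R = (=)")
      case True
      then have "u = 1"
        using q l by (simp add: u_def)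
      then show ?thesis
        unfolding eq using mix by simp
    next
      case False
      then have "\<omega> \<in> G"
        using KG \<omega> by blast
      then show ?thesis
        unfolding eq using G u mix
        by (intro convexD) (auto simp: free_states_def)
    qed
  qed
  then show ?thesis
    using l by (intro overhead_le_zeta_program[OF R F x \<rho> K(2)[OF \<omega>] \<epsilon>, of _ ?c])
      (simp_all add: ereal_divide_robustness field_simps)
qed

theorem theorem1:
  fixes F_in :: "(complex^'a^'a) set"
    and F :: "(complex^'n^'n) set"
    and F_m :: "(complex^('m::finite \<Rightarrow> 'n)^('m \<Rightarrow> 'n)) set"
    and \<psi> :: "complex^'n"
    and \<rho> :: "complex^'a^'a"
    and \<epsilon> :: real
  defines "\<psi>m \<equiv> (tensor_power \<psi> :: complex^('m \<Rightarrow> 'n))"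
  defines "C \<equiv> virtual_overhead (rng_operations F_in F_m) \<epsilon> \<rho> (ketbra \<psi>m)"
  assumes "free_states F_in" and "free_states F" and "free_states F_m"
    and "norm \<psi> = 1" and "ketbra \<psi> \<notin> F"
    and "density_operator \<rho>"
    and "0 \<le> \<epsilon>" and "\<epsilon> < 1"
  shows "(standard_robustness F (ketbra \<psi>) < \<infinity> \<longrightarrow>
            zeta_s F_in \<epsilon> \<rho> (inverse (resource_fidelity F_m (ketbra \<psi>m))) \<le> C \<and>
            C \<le> zeta_s F_in \<epsilon> \<rho> (standard_robustness F_m (ketbra \<psi>m) + 1))
       \<and> (constant_overlap F \<psi> \<longrightarrow>
            (constant_overlap F_m \<psi>m \<longrightarrow>
               zeta_g F_in \<epsilon> \<rho> (inverse (resource_fidelity F_m (ketbra \<psi>m))) \<le> C) \<and>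
            C \<le> zeta_g F_in \<epsilon> \<rho> (generalized_robustness F_m (ketbra \<psi>m) + 1))"
proof -
  have x: "norm \<psi>m = 1"
    unfolding \<psi>m_def by (rule norm_tensor_power[OF \<open>norm \<psi> = 1\<close>])
  obtain f where f: "resource_fidelity F_m (ketbra \<psi>m) = ereal f" "0 \<le> f"
    and f_le: "\<And>\<sigma>. \<sigma> \<in> F_m \<Longrightarrow> Re (cdot \<psi>m (\<sigma> *v \<psi>m)) \<le> f"
    using resource_fidelity_pure_real[OF \<open>free_states F_m\<close> x] by blast
  have "zeta_s F_in \<epsilon> \<rho> (inverse (resource_fidelity F_m (ketbra \<psi>m))) \<le> C"
    unfolding zeta_s_def C_def f(1)
    using f_le by (intro zeta_program_le_overhead[OF _ x \<open>density_operator \<rho>\<close>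
        ereal_divide_inverse[OF f(2)]]) simp_all
  moreover have "zeta_g F_in \<epsilon> \<rho> (inverse (resource_fidelity F_m (ketbra \<psi>m))) \<le> C"
    if const: "constant_overlap F_m \<psi>m"
  proof -
    obtain d where d: "\<And>\<sigma>. \<sigma> \<in> F_m \<Longrightarrow> cdot \<psi>m (\<sigma> *v \<psi>m) = d"
      using const by (auto simp: constant_overlap_def)
    have "F_m \<noteq> {}"
      using \<open>free_states F_m\<close> by (simp add: free_states_def)
    \<comment> \<open>A constant overlap equals its supremum over the nonempty set of free states,
      so the bound by \<open>f\<close> becomes the equality that \<open>zeta_g\<close>
      requires.\<close>
    then have "ereal f = ereal (Re d)"
      using resource_fidelity_pure[OF \<open>free_states F_m\<close> x] unfolding f(1) by (simp add: d)
    then show ?thesis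
      unfolding zeta_g_def C_def f(1)
      by (intro zeta_program_le_overhead[OF _ x \<open>density_operator \<rho>\<close>
          ereal_divide_inverse[OF f(2)]]) (simp_all add: d)
  qed
  moreover have "C \<le> zeta_s F_in \<epsilon> \<rho> (standard_robustness F_m (ketbra \<psi>m) + 1)"
    unfolding zeta_s_def C_def standard_robustness_def
    using assms x
    by (intro overhead_le_zeta_program_robustness[where K = F_m] compact_free_states)
      (auto simp: free_states_def)
  moreover have "C \<le> zeta_g F_in \<epsilon> \<rho> (generalized_robustness F_m (ketbra \<psi>m) + 1)"
    unfolding zeta_g_def C_def generalized_robustness_def
    using assms x
    by (intro overhead_le_zeta_program_robustness[where K = "{\<omega>. density_operator \<omega>}"]
        compact_density_operators) simp_all
  ultimately show ?thesis
    by blast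
qed

end
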